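(* Let $(i_1,j_1),(i_2,j_2)\in\{1,\ldots,7\}\times\{1,\ldots,4\}$ be such that $(j_1,j_2)\notin\{(2,4),(4,2)\}$ and $(i_1,i_2)\notin\{(2,7),(5,7),(7,2),(7,5),(7,7)\}$, and let $S$ be the corresponding K3 surface with hyper-K\"ahler structure and $(\rho^1,\rho^2)$ the corresponding pair of involutions described in the context. Thus $S$ (1) admits the pair $(\rho^1,\rho^2)$ of commuting simple involutions that are non-symplectic with respect to two complex structures $I_1$ and $I_2$ with $I_1I_2=-I_2I_1$, and (2) has $3$ points with $A_1$-singularities and $2$ points with $E_8$-singularities. The involutions $\rho^1$ and $\rho^2$ generate a group that is isomorphic to $\mathbb{Z}_2^2$ and acts on the Dynkin diagram $3A_1\cup 2E_8$. Let $M$ be a $\mathbb{Z}_2^2$-invariant subset of the nodes of $3A_1\cup 2E_8$ such that no node from $M$ corresponds to a $\widetilde{w}_i\in L$ that is fixed by $\mathbb{Z}_2^2$ (i.e. to a $\widetilde{w}_i$ with $\rho^1(\widetilde{w}_i)=\rho^2(\widetilde{w}_i)=\widetilde{w}_i$). Then there exists a K3 surface $S'$ with a hyper-K\"ahler structure that (1) admits a pair of commuting simple involutions that are non-symplectic with respect to two complex structures $I'_1$ and $I'_2$ with $I'_1I'_2=-I'_2I'_1$ and whose invariants $(r_i,a_i,\delta_i)$ are the same as those of $\rho^i$, $i=1,2$, and (2) whose singular set is described by the Dynkin diagram that we obtain by deleting the set $M$ of nodes from $3A_1\cup 2E_8$. In particular, $S'$ can be chosen as a smooth K3 surface if there is no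 $\widetilde{w}_i$ that is fixed by $\mathbb{Z}_2^2$.
   Context: K3 lattice and standard basis. $L = H_1\oplus H_2\oplus H_3\oplus(-E_8)_1\oplus(-E_8)_2$ is the K3 lattice, where each $H_i$ is a hyperbolic plane with basis $(u_1^i,u_2^i)$, $u_1^i\cdot u_1^i=u_2^i\cdot u_2^i=0$, $u_1^i\cdot u_2^i=1$, and each $(-E_8)_i$ is the negative definite $E_8$-lattice with a basis $(v_1^i,\ldots,v_8^i)$ of simple roots (the Gram matrices being the same for $i=1,2$). The standard basis of $L$ is $(w_1,\ldots,w_{22})=(u_1^1,u_2^1,u_1^2,u_2^2,u_1^3,u_2^3,v_1^1,\ldots,v_8^1,v_1^2,\ldots,v_8^2)$. The maps $\rho_1^i$, $\rho_2^j$ and $\tau$. Let $s$ denote the isometry of $H_k$ that interchanges $u_1^k$ and $u_2^k$. Writing an isometry of $H_1\oplus H_2\oplus H_3$ that preserves each summand as a triple of its restrictions, define $\rho_1^1=(\mathrm{id},-\mathrm{id},-\mathrm{id})$, $\rho_1^2=(\mathrm{id},-s,-\mathrm{id})$, $\rho_1^3=(\mathrm{id},-s,-s)$, $\rho_1^4=(s,-\mathrm{id},-\mathrm{id})$, $\rho_1^5=(s,-s,-\mathrm{id})$, $\rho_1^6=(s,-s,-s)$; and $\rho_1^7$ is given by $u_k^1\mapsto u_k^2$, $u_k^2\mapsto u_k^1$, $u_k^3\mapsto -u_k^3$ ($k=1,2$). On $(-E_8)_1\oplus(-E_8)_2$ define $\rho_2^1(x_1,x_2)=(x_1,x_2)$,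 $\rho_2^2(x_1,x_2)=(-x_1,x_2)$, $\rho_2^3(x_1,x_2)=(-x_1,-x_2)$, $\rho_2^4(x_1,x_2)=(x_2,x_1)$ (with $v_k^1\leftrightarrow v_k^2$ identified). Let $\tau$ be the isometry of $H_1\oplus H_2\oplus H_3$ with $\tau(u_k^l)=u_k^{4-l}$ for $k\in\{1,2\}$, $l\in\{1,2,3\}$. Possibly singular K3 surfaces. Marked K3 surfaces with at most ADE-singularities equipped with a hyper-K\"ahler structure correspond to triples $\alpha=(x,y,z)\in L_{\mathbb{R}}^3$ with $x^2=y^2=z^2>0$ and $x\cdot y=x\cdot z=y\cdot z=0$, where $x,y,z$ are the images of the three K\"ahler classes; the singular points are described by the root system $\mathcal{D}_\alpha=\{d\in L\mid d^2=-2,\ x\cdot d=y\cdot d=z\cdot d=0\}$, each connected component of its Dynkin diagram giving one singular point of that type (so the surface is smooth iff $\mathcal{D}_\alpha=\emptyset$). Pairs of involutions. The complex structures $I_1$ and $I_2$ belong to the hyper-K\"ahler structure and have K\"ahler classes $z$ and $y$ respectively. A pair of commuting simple involutions, non-symplectic with respect to $I_1$ and $I_2$, is a pair of commuting isometric involutions of the surface induced by commuting involutions $\rho^1,\rho^2$ of $L$ with $\rho^1(x)=-x$, $\rho^1(y)=-y$, $\rho^1(z)=z$, $\rho^2(x)=-x$, $\rho^2(y)=y$, $\rho^2(z)=-z$, each of which maps, for a suitable marking, every $w_i$ to some $\pm w_j$ (simplicity), and whose fixed lattices are hyperbolic and 2-elementary. ("Induced" means that the pull-back on $H^2(S,\mathbb{R})$,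 identified with the orthogonal complement of $\mathcal{D}_\alpha$ in $L_{\mathbb{R}}$, is the restriction of the lattice involution.) The invariants $(r,a,\delta)$ of such an involution with fixed lattice $N\subseteq L$ are: $r$ the rank of $N$, $N^*/N\cong\mathbb{Z}_2^a$ ($N^*$ the dual lattice), $\delta=0$ if $x^2\in\mathbb{Z}$ for all $x\in N^*$ and $\delta=1$ otherwise. The surface $S$ and the pair $(\rho^1,\rho^2)$. If $i_1,i_2\neq 7$: $\rho^1=\rho_1^{i_1}\oplus\rho_2^{j_1}$, $\rho^2=\tau^{-1}\rho_1^{i_2}\tau\oplus\rho_2^{j_2}$, and $S$ is determined by $x=u_1^2+u_2^2$, $y=u_1^3+u_2^3$, $z=u_1^1+u_2^1$. If $i_1=7$: $\rho^1=\rho_1^{7}\oplus\rho_2^{j_1}$, $\rho^2=\tau^{-1}\rho_1^{i_2}\tau\oplus\rho_2^{j_2}$, and $S$ is determined by $x=u_1^1+u_2^1-u_1^2-u_2^2$, $y=\sqrt{2}(u_1^3+u_2^3)$, $z=u_1^1+u_2^1+u_1^2+u_2^2$. If $i_2=7$: the same with the roles of the indices $1,2$ and of $y,z$ interchanged, i.e. $\rho^1=\tau^{-1}\rho_1^{i_1}\tau\oplus\rho_2^{j_1}$, $\rho^2=\rho_1^7\oplus\rho_2^{j_2}$, $x=u_1^1+u_2^1-u_1^2-u_2^2$, $y=u_1^1+u_2^1+u_1^2+u_2^2$, $z=\sqrt{2}(u_1^3+u_2^3)$. The nodes of the diagram $3A_1\cup 2E_8$ of $S$ correspond to $(\widetilde{w}_1,\ldots,\widetilde{w}_{19})=(u_1^1-u_2^1,u_1^2-u_2^2,u_1^3-u_2^3,v_1^1,\ldots,v_8^1,v_1^2,\ldots,v_8^2)$.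 Each of $\rho^1,\rho^2$ maps every $\widetilde{w}_i$ to some $\pm\widetilde{w}_j$, and the action of $\mathbb{Z}_2^2$ on the Dynkin diagram is the resulting action on the nodes, ignoring signs. *)

theory Defs
  imports
    "HOL-Analysis.Analysis"
    "HOL-Algebra.Elementary_Groups"
    "HOL-Algebra.Product_Groups"
    "HOL-Algebra.Group_Action"
    "HOL-Algebra.Generated_Groups"
begin

section \<open>The K3 lattice\<close>

text \<open>
  The three index types are numeral types, whose elements are residues: in type \<open>n\<close> the
  numerals \<open>1, \<dots>, n\<close> are the \<open>n\<close> distinct elements (with \<open>n = 0\<close>), so the
  one-based indices of the literature can be used literally.
  A vector \<open>(h, e)\<close> of the real K3 space has component \<open>h $ i\<close> in the i-th hyperbolic plane
  and \<open>e $ i\<close> in the i-th copy of the negative definite E8-lattice (tensored with the reals).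
\<close>

type_synonym hyp_space = "real^2^3"
type_synonym e8_space = "real^8^2"
type_synonym k3_space = "hyp_space \<times> e8_space"

text \<open>The E8 diagram: the chain 1-2-3-4-5-6-7 with the node 8 attached to the node 5.\<close>

definition e8_edge :: "8 \<Rightarrow> 8 \<Rightarrow> bool" where
  "e8_edge k l \<longleftrightarrow>
     {k, l} \<in> {{1, 2}, {2, 3}, {3, 4}, {4, 5}, {5, 6}, {6, 7}, {5, 8}}"

definition hyp_form :: "real^2 \<Rightarrow> real^2 \<Rightarrow> real" where
  "hyp_form p q = p $ 1 * q $ 2 + p $ 2 * q $ 1"

definition neg_e8_form :: "real^8 \<Rightarrow> real^8 \<Rightarrow> real" where
  "neg_e8_form p q =
     (\<Sum>k\<in>UNIV. \<Sum>l\<in>UNIV.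
        (if k = l then - 2 else if e8_edge k l then 1 else 0) * p $ k * q $ l)"

definition k3_form :: "k3_space \<Rightarrow> k3_space \<Rightarrow> real" where
  "k3_form v w =
     (\<Sum>i\<in>UNIV. hyp_form (fst v $ i) (fst w $ i)) +
     (\<Sum>i\<in>UNIV. neg_e8_form (snd v $ i) (snd w $ i))"

definition k3_lattice :: "k3_space set" where
  "k3_lattice = {(h, e). (\<forall>i k. h $ i $ k \<in> \<int>) \<and> (\<forall>i k. e $ i $ k \<in> \<int>)}"

definition u :: "2 \<Rightarrow> 3 \<Rightarrow> k3_space" where
  "u k i = (axis i (axis k 1), 0)"

definition v :: "8 \<Rightarrow> 2 \<Rightarrow> k3_space" where
  "v k i = (0, axis i (axis k 1))"

definition standard_basis :: "k3_space set" where
  "standard_basis = {u k i | k i. True} \<union> {v k i | k i. True}"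

text \<open>An isometry of the lattice is identified with its linear extension.\<close>

definition isometry :: "(k3_space \<Rightarrow> k3_space) \<Rightarrow> bool" where
  "isometry f \<longleftrightarrow>
     linear f \<and> f ` k3_lattice = k3_lattice \<and>
     (\<forall>a b. k3_form (f a) (f b) = k3_form a b)"

definition isometry_group :: "(k3_space \<Rightarrow> k3_space) monoid" where
  "isometry_group = \<lparr>carrier = {f. isometry f}, mult = (\<circ>), one = id\<rparr>"


section \<open>Sublattices and their invariants\<close>

definition lattice_rank :: "k3_space set \<Rightarrow> nat" where
  "lattice_rank N = dim N"

definition dual_lattice :: "k3_space set \<Rightarrow> k3_space set" where
  "dual_lattice N = {a \<in> span N. \<forall>b\<in>N. k3_form a b \<in> \<int>}"

definition discriminant_group :: "k3_space set \<Rightarrow> k3_space set monoid" where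
  "discriminant_group N = \<lparr>carrier = dual_lattice N, mult = (+), one = 0\<rparr> Mod N"

abbreviation elementary_2_group :: "nat \<Rightarrow> (nat \<Rightarrow> int) monoid" where
  "elementary_2_group n \<equiv> product_group {..<n} (\<lambda>_. integer_mod_group 2)"

definition two_elementary :: "k3_space set \<Rightarrow> bool" where
  "two_elementary N \<longleftrightarrow> (\<exists>n. discriminant_group N \<cong> elementary_2_group n)"

definition has_signature :: "k3_space set \<Rightarrow> nat \<Rightarrow> nat \<Rightarrow> bool" where
  "has_signature N p q \<longleftrightarrow>
     (\<exists>P Q. finite P \<and> finite Q \<and> card P = p \<and> card Q = q \<and> P \<inter> Q = {} \<and>
        independent (P \<union> Q) \<and> span (P \<union> Q) = span N \<and>
        (\<forall>a\<in>P \<union> Q. \<forall>b\<in>P \<union> Q. a \<noteq> b \<longrightarrow> k3_form a b = 0) \<and>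
        (\<forall>a\<in>P. k3_form a a > 0) \<and> (\<forall>a\<in>Q. k3_form a a < 0))"

definition hyperbolic :: "k3_space set \<Rightarrow> bool" where
  "hyperbolic N \<longleftrightarrow> (\<exists>q. has_signature N 1 q)"

definition fixed_lattice :: "(k3_space \<Rightarrow> k3_space) \<Rightarrow> k3_space set" where
  "fixed_lattice f = {a \<in> k3_lattice. f a = a}"

text \<open>The triple \<open>(r, a, \<delta>)\<close>; the second entry is only meaningful for 2-elementary lattices.\<close>

definition invariants :: "(k3_space \<Rightarrow> k3_space) \<Rightarrow> nat \<times> nat \<times> nat" where
  "invariants f =
     (let N = fixed_lattice f in
       (lattice_rank N,
        THE n. discriminant_group N \<cong> elementary_2_group n,
        if \<forall>a\<in>dual_lattice N. k3_form a a \<in> \<int> then 0 else 1))"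


section \<open>Hyper-Kaehler K3 surfaces with ADE-singularities\<close>

text \<open>
  By the Torelli theorem for hyper-Kaehler K3 surfaces with at most ADE-singularities, such a
  surface with a marking is given by the triple \<open>(x, y, z)\<close> of its three Kaehler classes.
  The anti-commuting complex structures \<open>I_1\<close> and \<open>I_2\<close> are those with Kaehler class
  \<open>z\<close> and \<open>y\<close>, respectively.
\<close>

type_synonym k3_triple = "k3_space \<times> k3_space \<times> k3_space"

definition hyper_kaehler_k3 :: "k3_triple \<Rightarrow> bool" where
  "hyper_kaehler_k3 = (\<lambda>(x, y, z).
     k3_form x x = k3_form y y \<and> k3_form y y = k3_form z z \<and> k3_form x x > 0 \<and>
     k3_form x y = 0 \<and> k3_form x z = 0 \<and> k3_form y z = 0)"

definition root_system :: "k3_triple \<Rightarrow> k3_space set" where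
  "root_system = (\<lambda>(x, y, z).
     {d \<in> k3_lattice. k3_form d d = - 2 \<and>
        k3_form x d = 0 \<and> k3_form y d = 0 \<and> k3_form z d = 0})"

text \<open>
  \<open>V\<close> and \<open>E\<close> are the node set and the adjacency relation of a simply laced diagram; \<open>b\<close> labels
  its nodes by simple roots.  As roots have square -2, distinct simple roots have product 0 or 1,
  and 1 exactly if their nodes are joined.
\<close>

definition dynkin_labelling ::
  "k3_space set \<Rightarrow> 'n set \<Rightarrow> ('n \<Rightarrow> 'n \<Rightarrow> bool) \<Rightarrow> ('n \<Rightarrow> k3_space) \<Rightarrow> bool" where
  "dynkin_labelling D V E b \<longleftrightarrow>
     finite V \<and> inj_on b V \<and> b ` V \<subseteq> D \<and> independent (b ` V) \<and>
     (\<forall>d\<in>D. \<exists>c :: 'n \<Rightarrow> nat.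
        d = (\<Sum>n\<in>V. real (c n) *\<^sub>R b n) \<or> d = - (\<Sum>n\<in>V. real (c n) *\<^sub>R b n)) \<and>
     (\<forall>m\<in>V. \<forall>n\<in>V. m \<noteq> n \<longrightarrow> k3_form (b m) (b n) = (if E m n then 1 else 0))"

definition has_dynkin_diagram ::
  "k3_space set \<Rightarrow> 'n set \<Rightarrow> ('n \<Rightarrow> 'n \<Rightarrow> bool) \<Rightarrow> bool" where
  "has_dynkin_diagram D V E \<longleftrightarrow> (\<exists>b. dynkin_labelling D V E b)"

text \<open>A single marking has to exhibit the simplicity of both involutions.\<close>

definition simple_pair :: "(k3_space \<Rightarrow> k3_space) \<Rightarrow> (k3_space \<Rightarrow> k3_space) \<Rightarrow> bool" where
  "simple_pair f g \<longleftrightarrow>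
     (\<exists>\<phi>. isometry \<phi> \<and>
        (\<forall>\<sigma>\<in>{f, g}. \<forall>w\<in>standard_basis. \<exists>w'\<in>standard_basis.
           (\<phi> \<circ> \<sigma> \<circ> inv_into UNIV \<phi>) w = w' \<or> (\<phi> \<circ> \<sigma> \<circ> inv_into UNIV \<phi>) w = - w'))"

text \<open>
  A pair of commuting simple involutions that are non-symplectic with respect to the complex
  structures with Kaehler classes \<open>z\<close> and \<open>y\<close>, given by the lattice involutions inducing it.
\<close>

definition admits_pair ::
  "k3_triple \<Rightarrow> (k3_space \<Rightarrow> k3_space) \<Rightarrow> (k3_space \<Rightarrow> k3_space) \<Rightarrow> bool" where
  "admits_pair = (\<lambda>(x, y, z) f g.
     isometry f \<and> isometry g \<and> f \<circ> f = id \<and> g \<circ> g = id \<and> f \<circ> g = g \<circ> f \<and>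
     f x = - x \<and> f y = - y \<and> f z = z \<and>
     g x = - x \<and> g y = y \<and> g z = - z \<and>
     simple_pair f g \<and>
     hyperbolic (fixed_lattice f) \<and> two_elementary (fixed_lattice f) \<and>
     hyperbolic (fixed_lattice g) \<and> two_elementary (fixed_lattice g))"


section \<open>The explicit surfaces and involutions\<close>

definition hyp_swap :: "real^2 \<Rightarrow> real^2" where
  "hyp_swap p = vector [p $ 2, p $ 1]"

definition hyp_triple ::
  "(real^2 \<Rightarrow> real^2) \<Rightarrow> (real^2 \<Rightarrow> real^2) \<Rightarrow> (real^2 \<Rightarrow> real^2) \<Rightarrow> hyp_space \<Rightarrow> hyp_space" where
  "hyp_triple f1 f2 f3 h = vector [f1 (h $ 1), f2 (h $ 2), f3 (h $ 3)]"

definition rho1 :: "nat \<Rightarrow> hyp_space \<Rightarrow> hyp_space" where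
  "rho1 i =
     [hyp_triple id uminus uminus,
      hyp_triple id (uminus \<circ> hyp_swap) uminus,
      hyp_triple id (uminus \<circ> hyp_swap) (uminus \<circ> hyp_swap),
      hyp_triple hyp_swap uminus uminus,
      hyp_triple hyp_swap (uminus \<circ> hyp_swap) uminus,
      hyp_triple hyp_swap (uminus \<circ> hyp_swap) (uminus \<circ> hyp_swap),
      (\<lambda>h. vector [h $ 2, h $ 1, - (h $ 3)])] ! (i - 1)"

definition rho2 :: "nat \<Rightarrow> e8_space \<Rightarrow> e8_space" where
  "rho2 j =
     [id,
      (\<lambda>e. vector [- (e $ 1), e $ 2]),
      (\<lambda>e. vector [- (e $ 1), - (e $ 2)]),
      (\<lambda>e. vector [e $ 2, e $ 1])] ! (j - 1)"

definition tau :: "hyp_space \<Rightarrow> hyp_space" where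
  "tau h = vector [h $ 3, h $ 2, h $ 1]"

definition rho1_conj :: "nat \<Rightarrow> hyp_space \<Rightarrow> hyp_space" where
  "rho1_conj i = inv_into UNIV tau \<circ> rho1 i \<circ> tau"

text \<open>
  The two involutions and the triple belonging to \<open>(i1, j1)\<close> and \<open>(i2, j2)\<close>; the case
  \<open>i1 = i2 = 7\<close> is excluded throughout.
\<close>

definition first_involution :: "nat \<Rightarrow> nat \<Rightarrow> nat \<Rightarrow> k3_space \<Rightarrow> k3_space" where
  "first_involution i1 i2 j1 =
     map_prod (if i2 = 7 then rho1_conj i1 else rho1 i1) (rho2 j1)"

definition second_involution :: "nat \<Rightarrow> nat \<Rightarrow> nat \<Rightarrow> k3_space \<Rightarrow> k3_space" where
  "second_involution i1 i2 j2 =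
     map_prod (if i2 = 7 then rho1 7 else rho1_conj i2) (rho2 j2)"

definition k3_surface :: "nat \<Rightarrow> nat \<Rightarrow> k3_triple" where
  "k3_surface i1 i2 =
     (if i1 = 7 then
        (u 1 1 + u 2 1 - u 1 2 - u 2 2,
         sqrt 2 *\<^sub>R (u 1 3 + u 2 3),
         u 1 1 + u 2 1 + u 1 2 + u 2 2)
      else if i2 = 7 then
        (u 1 1 + u 2 1 - u 1 2 - u 2 2,
         u 1 1 + u 2 1 + u 1 2 + u 2 2,
         sqrt 2 *\<^sub>R (u 1 3 + u 2 3))
      else (u 1 2 + u 2 2, u 1 3 + u 2 3, u 1 1 + u 2 1))"

text \<open>
  The diagram \<open>3A_1 \<union> 2E_8\<close>: the nodes \<open>Inl i\<close> are isolated and, for \<open>i = 1, 2\<close>, the nodes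
  \<open>Inr (i, k)\<close> form a copy of the E8 diagram.
\<close>

type_synonym node = "3 + 2 \<times> 8"

fun node_edge :: "node \<Rightarrow> node \<Rightarrow> bool" where
  "node_edge (Inr (i, k)) (Inr (j, l)) \<longleftrightarrow> i = j \<and> e8_edge k l"
| "node_edge _ _ \<longleftrightarrow> False"

fun node_root :: "node \<Rightarrow> k3_space" where
  "node_root (Inl i) = u 1 i - u 2 i"
| "node_root (Inr (i, k)) = v k i"

definition node_action :: "(k3_space \<Rightarrow> k3_space) \<Rightarrow> node \<Rightarrow> node" where
  "node_action g n =
     (THE m. g (node_root n) = node_root m \<or> g (node_root n) = - node_root m)"

definition generated_group ::
  "(k3_space \<Rightarrow> k3_space) \<Rightarrow> (k3_space \<Rightarrow> k3_space) \<Rightarrow> (k3_space \<Rightarrow> k3_space) monoid" where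
  "generated_group f g = isometry_group \<lparr>carrier := generate isometry_group {f, g}\<rparr>"

end

theory Submission
  imports Defs
begin

text \<open>
  The involutions of \<open>S'\<close> are \<open>\<rho>\<^sup>1, \<rho>\<^sup>2\<close> themselves; only the Kaehler classes move.  The classes
  \<open>x, y, z\<close> of \<open>S\<close> lie on lines through lattice vectors, and the lattice is unimodular, so there is a
  lattice vector \<open>\<theta>\<close> with \<open>\<theta> \<cdot> w\<^sub>n = \<kappa>(C)\<close> for each node \<open>n\<close> of \<open>M\<close> in the component \<open>C\<close> and
  \<open>\<theta> \<cdot> w\<^sub>n = 0\<close> for the other nodes, where the \<open>\<kappa>(C)\<close> are positive and distinct.  Add to large
  multiples of \<open>x, y, z\<close> an irrational multiple of the components of \<open>\<theta>\<close> in the eigenspaces \<open>(-,-)\<close>,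
  \<open>(-,+)\<close> and \<open>(+,-)\<close> of \<open>(\<rho>\<^sup>1, \<rho>\<^sup>2)\<close>, and normalise.  By irrationality a root of \<open>S'\<close> is a root
  \<open>d\<close> of \<open>S\<close> with equal products with all images of \<open>\<theta>\<close> under the group.  Such a \<open>d\<close> is, up to sign,
  a nonnegative combination of the nodes of one component; if a node of \<open>M\<close> occurred in it, then
  that component would be fixed with sign \<open>1\<close> by both involutions, contrary to the choice of \<open>M\<close>.
  So the roots of \<open>S'\<close> are those supported outside \<open>M\<close>.

  The fixed lattices are hyperbolic because \<open>\<langle>x, y, z\<rangle>\<^sup>\<bottom>\<close> is negative definite, and 2-elementary
  because \<open>b + \<rho>(b)\<close> is fixed for every lattice vector \<open>b\<close>, so that twice a dual vector has integral
  products with the whole lattice.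
\<close>

section \<open>Definiteness, evenness and unimodularity of the E8 lattice\<close>

section \<open>The E8 form\<close>

lemma exhaust_8:
  fixes x :: 8
  shows "x = 1 \<or> x = 2 \<or> x = 3 \<or> x = 4 \<or> x = 5 \<or> x = 6 \<or> x = 7 \<or> x = 8"
proof (induct x)
  case (of_int z)
  then have "z = 0 \<or> z = 1 \<or> z = 2 \<or> z = 3 \<or> z = 4 \<or> z = 5 \<or> z = 6 \<or> z = 7" by fastforce
  then show ?case by auto
qed

lemma UNIV_8: "UNIV = {1, 2, 3, 4, 5, 6, 7, 8::8}"
  using exhaust_8 by auto

lemma forall_8: "(\<forall>i::8. P i) \<longleftrightarrow> P 1 \<and> P 2 \<and> P 3 \<and> P 4 \<and> P 5 \<and> P 6 \<and> P 7 \<and> P 8"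
  by (metis exhaust_8)

lemma sum_8: "sum f (UNIV::8 set) = f 1 + f 2 + f 3 + f 4 + f 5 + f 6 + f 7 + f 8"
  unfolding UNIV_8 by (simp add: ac_simps)

lemma e8_edge_irrefl: "\<not> e8_edge k k"
  by (simp add: e8_edge_def)

lemma neg_e8_form_expand:
  "neg_e8_form p q =
     - 2 * (p$1 * q$1 + p$2 * q$2 + p$3 * q$3 + p$4 * q$4 + p$5 * q$5 + p$6 * q$6 + p$7 * q$7 + p$8 * q$8)
     + p$1 * q$2 + p$2 * q$1 + p$2 * q$3 + p$3 * q$2 + p$3 * q$4 + p$4 * q$3 + p$4 * q$5 + p$5 * q$4
     + p$5 * q$6 + p$6 * q$5 + p$6 * q$7 + p$7 * q$6 + p$5 * q$8 + p$8 * q$5"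
  unfolding neg_e8_form_def sum_8 by (simp add: e8_edge_def doubleton_eq_iff algebra_simps)

lemma neg_e8_form_commute: "neg_e8_form p q = neg_e8_form q p"
  by (simp add: neg_e8_form_expand algebra_simps)

lemma bilinear_neg_e8_form: "bilinear neg_e8_form"
  unfolding bilinear_def by (auto intro!: linearI simp: neg_e8_form_expand algebra_simps)

text \<open>Completing squares along the tree, from its three ends towards the node 5.\<close>

lemma neg_e8_form_squares:
  "- neg_e8_form p p =
     2 * (p$1 - p$2 / 2)\<^sup>2 + 3/2 * (p$2 - 2/3 * p$3)\<^sup>2 + 4/3 * (p$3 - 3/4 * p$4)\<^sup>2
     + 5/4 * (p$4 - 4/5 * p$5)\<^sup>2 + 2 * (p$7 - p$6 / 2)\<^sup>2 + 3/2 * (p$6 - 2/3 * p$5)\<^sup>2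
     + 2 * (p$8 - p$5 / 2)\<^sup>2 + 1/30 * (p$5)\<^sup>2"
  unfolding neg_e8_form_expand by (simp add: power2_eq_square field_simps)

lemma neg_e8_form_nonpos: "neg_e8_form p p \<le> 0"
proof -
  have "0 \<le> - neg_e8_form p p"
    unfolding neg_e8_form_squares by (intro add_nonneg_nonneg mult_nonneg_nonneg) auto
  then show ?thesis by simp
qed

lemma neg_e8_form_eq_0_iff: "neg_e8_form p p = 0 \<longleftrightarrow> p = 0"
proof
  assume "neg_e8_form p p = 0"
  then have *: "2 * (p$1 - p$2 / 2)\<^sup>2 + 3/2 * (p$2 - 2/3 * p$3)\<^sup>2 + 4/3 * (p$3 - 3/4 * p$4)\<^sup>2
     + 5/4 * (p$4 - 4/5 * p$5)\<^sup>2 + 2 * (p$7 - p$6 / 2)\<^sup>2 + 3/2 * (p$6 - 2/3 * p$5)\<^sup>2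
     + 2 * (p$8 - p$5 / 2)\<^sup>2 + 1/30 * (p$5)\<^sup>2 = 0"
    using neg_e8_form_squares[of p] by simp
  have "(p$1 - p$2 / 2)\<^sup>2 = 0 \<and> (p$2 - 2/3 * p$3)\<^sup>2 = 0 \<and> (p$3 - 3/4 * p$4)\<^sup>2 = 0
     \<and> (p$4 - 4/5 * p$5)\<^sup>2 = 0 \<and> (p$7 - p$6 / 2)\<^sup>2 = 0 \<and> (p$6 - 2/3 * p$5)\<^sup>2 = 0
     \<and> (p$8 - p$5 / 2)\<^sup>2 = 0 \<and> (p$5)\<^sup>2 = 0"
    using * zero_le_power2[of "p$1 - p$2 / 2"] zero_le_power2[of "p$2 - 2/3 * p$3"]
      zero_le_power2[of "p$3 - 3/4 * p$4"] zero_le_power2[of "p$4 - 4/5 * p$5"]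
      zero_le_power2[of "p$7 - p$6 / 2"] zero_le_power2[of "p$6 - 2/3 * p$5"]
      zero_le_power2[of "p$8 - p$5 / 2"] zero_le_power2[of "p$5"]
    by linarith
  \<comment> \<open>The last square kills the coordinate at the branch node 5; the other squares
    pass this on outwards along the three arms.\<close>
  then show "p = 0"
    by (simp add: vec_eq_iff forall_8)
qed (simp add: neg_e8_form_expand)

text \<open>The diagonal Gram entries are even and every edge contributes twice; the witness is half
  of the resulting polynomial.\<close>

lemma neg_e8_form_even:
  assumes "\<And>k. p $ k \<in> \<int>"
  shows "\<exists>m::int. neg_e8_form p p = 2 * of_int m"
proof -
  have "\<forall>k. \<exists>m::int. p $ k = of_int m"
    using assms by (meson Ints_cases)
  then obtain m :: "8 \<Rightarrow> int" where m: "\<And>k. p $ k = of_int (m k)"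
    by metis
  show ?thesis
    by (rule exI[of _ "- (m 1 * m 1 + m 2 * m 2 + m 3 * m 3 + m 4 * m 4 + m 5 * m 5 + m 6 * m 6
        + m 7 * m 7 + m 8 * m 8) + m 1 * m 2 + m 2 * m 3 + m 3 * m 4 + m 4 * m 5 + m 5 * m 6
        + m 6 * m 7 + m 5 * m 8"])
      (simp add: neg_e8_form_expand m algebra_simps)
qed

lemma sum_mult_axis: "(\<Sum>l\<in>UNIV. g l * axis k (1::real) $ l) = g k"
proof -
  have "(\<Sum>l\<in>UNIV. g l * axis k (1::real) $ l) = (\<Sum>l\<in>UNIV. if l = k then g l else 0)"
    by (rule sum.cong) (auto simp: axis_def)
  then show ?thesis by simp
qed

lemma neg_e8_form_axis_axis:
  "neg_e8_form (axis k 1) (axis l 1) = (if k = l then - 2 else if e8_edge k l then 1 else 0)"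
proof -
  have "neg_e8_form (axis k 1) (axis l 1) =
      (\<Sum>k'\<in>UNIV. (if k' = l then - 2 else if e8_edge k' l then 1 else 0) * axis k 1 $ k')"
    unfolding neg_e8_form_def by (subst sum_mult_axis) simp
  then show ?thesis
    by (simp only: sum_mult_axis)
qed

text \<open>The rows are those of the inverse of the Gram matrix, which is integral.\<close>

definition e8_dual :: "(8 \<Rightarrow> real) \<Rightarrow> real^8" where
  "e8_dual t = - vector
     [2 * t 1 + 3 * t 2 + 4 * t 3 + 5 * t 4 + 6 * t 5 + 4 * t 6 + 2 * t 7 + 3 * t 8,
      3 * t 1 + 6 * t 2 + 8 * t 3 + 10 * t 4 + 12 * t 5 + 8 * t 6 + 4 * t 7 + 6 * t 8,
      4 * t 1 + 8 * t 2 + 12 * t 3 + 15 * t 4 + 18 * t 5 + 12 * t 6 + 6 * t 7 + 9 * t 8,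
      5 * t 1 + 10 * t 2 + 15 * t 3 + 20 * t 4 + 24 * t 5 + 16 * t 6 + 8 * t 7 + 12 * t 8,
      6 * t 1 + 12 * t 2 + 18 * t 3 + 24 * t 4 + 30 * t 5 + 20 * t 6 + 10 * t 7 + 15 * t 8,
      4 * t 1 + 8 * t 2 + 12 * t 3 + 16 * t 4 + 20 * t 5 + 14 * t 6 + 7 * t 7 + 10 * t 8,
      2 * t 1 + 4 * t 2 + 6 * t 3 + 8 * t 4 + 10 * t 5 + 7 * t 6 + 4 * t 7 + 5 * t 8,
      3 * t 1 + 6 * t 2 + 9 * t 3 + 12 * t 4 + 15 * t 5 + 10 * t 6 + 5 * t 7 + 8 * t 8]"

lemma vector_8:
  "vector [a1, a2, a3, a4, a5, a6, a7, a8] $ (1::8) = a1"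
  "vector [a1, a2, a3, a4, a5, a6, a7, a8] $ (2::8) = a2"
  "vector [a1, a2, a3, a4, a5, a6, a7, a8] $ (3::8) = a3"
  "vector [a1, a2, a3, a4, a5, a6, a7, a8] $ (4::8) = a4"
  "vector [a1, a2, a3, a4, a5, a6, a7, a8] $ (5::8) = a5"
  "vector [a1, a2, a3, a4, a5, a6, a7, a8] $ (6::8) = a6"
  "vector [a1, a2, a3, a4, a5, a6, a7, a8] $ (7::8) = a7"
  "vector [a1, a2, a3, a4, a5, a6, a7, a8] $ (8::8) = a8"
  unfolding vector_def by auto

lemma neg_e8_form_e8_dual: "neg_e8_form (e8_dual t) (axis k 1) = t k"
proof -
  have "\<forall>k. neg_e8_form (e8_dual t) (axis k 1) = t k"
    unfolding forall_8 neg_e8_form_expand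
    by (simp add: e8_dual_def vector_8 axis_def)
  then show ?thesis ..
qed

text \<open>With the preceding lemma this makes \<open>e8_dual\<close> the two-sided inverse of
  pairing with the simple roots. This direction gives unimodularity, the other one produces vectors
  with prescribed products.\<close>

lemma e8_dual_neg_e8_form: "e8_dual (\<lambda>k. neg_e8_form p (axis k 1)) = p"
  unfolding neg_e8_form_expand
  by (simp add: vec_eq_iff forall_8 e8_dual_def vector_8 axis_def)

lemma e8_dual_Ints: "(\<And>k. t k \<in> \<int>) \<Longrightarrow> e8_dual t $ l \<in> \<int>"
proof -
  assume "\<And>k. t k \<in> \<int>"
  then have "\<forall>l. e8_dual t $ l \<in> \<int>"
    unfolding forall_8 by (simp add: e8_dual_def vector_8)
  then show ?thesis ..
qed

section \<open>Coordinates as pairings, integrality and unimodularity of the K3 lattice\<close>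

section \<open>The K3 form and lattice\<close>

lemma bilinear_k3_form: "bilinear k3_form"
proof -
  have E: "neg_e8_form (a + b) c = neg_e8_form a c + neg_e8_form b c"
    "neg_e8_form c (a + b) = neg_e8_form c a + neg_e8_form c b"
    "neg_e8_form (r *\<^sub>R a) c = r * neg_e8_form a c"
    "neg_e8_form c (r *\<^sub>R a) = r * neg_e8_form c a" for a b c r
    using bilinear_neg_e8_form
    by (simp_all add: bilinear_ladd bilinear_radd bilinear_lmul bilinear_rmul)
  show ?thesis
    unfolding bilinear_def
    by (auto intro!: linearI simp: k3_form_def hyp_form_def sum_2 sum_3 E algebra_simps)
qed

lemmas k3_form_simps =
  bilinear_ladd[OF bilinear_k3_form] bilinear_radd[OF bilinear_k3_form]
  bilinear_lsub[OF bilinear_k3_form] bilinear_rsub[OF bilinear_k3_form]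
  bilinear_lneg[OF bilinear_k3_form] bilinear_rneg[OF bilinear_k3_form]
  bilinear_lmul[OF bilinear_k3_form] bilinear_rmul[OF bilinear_k3_form]
  bilinear_lzero[OF bilinear_k3_form] bilinear_rzero[OF bilinear_k3_form]

lemma k3_form_sum_left: "k3_form (\<Sum>i\<in>A. a i) b = (\<Sum>i\<in>A. k3_form (a i) b)"
  by (induction A rule: infinite_finite_induct) (simp_all add: k3_form_simps)

lemma k3_form_commute: "k3_form a b = k3_form b a"
  by (simp add: k3_form_def hyp_form_def sum_2 sum_3 neg_e8_form_commute)

text \<open>Both basis vectors of a hyperbolic plane are isotropic, so pairing with one reads off
  the coordinate at the other; hence the crossed indices.\<close>

lemma k3_form_u:
  "k3_form a (u 1 i) = fst a $ i $ 2" "k3_form a (u 2 i) = fst a $ i $ 1"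
proof -
  have "neg_e8_form p 0 = 0" for p
    by (simp add: neg_e8_form_def)
  moreover have "(\<Sum>j\<in>UNIV. hyp_form (fst a $ j) (axis i (axis 1 1) $ j)) = fst a $ i $ 2"
    "(\<Sum>j\<in>UNIV. hyp_form (fst a $ j) (axis i (axis 2 1) $ j)) = fst a $ i $ 1"
    using exhaust_3[of i] by (auto simp: sum_3 hyp_form_def axis_def)
  ultimately show "k3_form a (u 1 i) = fst a $ i $ 2" "k3_form a (u 2 i) = fst a $ i $ 1"
    by (simp_all add: k3_form_def u_def)
qed

lemma k3_form_v: "k3_form a (v k j) = neg_e8_form (snd a $ j) (axis k 1)"
proof -
  have "neg_e8_form p 0 = 0" for p
    by (simp add: neg_e8_form_def)
  then show ?thesis
    using exhaust_2[of j] by (auto simp: k3_form_def v_def sum_2 hyp_form_def axis_def)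
qed

lemma k3_vector_expansion:
  "a = (\<Sum>i\<in>UNIV. \<Sum>k\<in>UNIV. (fst a $ i $ k) *\<^sub>R u k i) + (\<Sum>j\<in>UNIV. \<Sum>k\<in>UNIV. (snd a $ j $ k) *\<^sub>R v k j)"
proof -
  have 1: "(\<Sum>k\<in>UNIV. p $ k *\<^sub>R axis i (axis k (1::real))) = axis i p" for p :: "real^'n" and i :: "'m::finite"
    by (auto simp: vec_eq_iff axis_def sum_component intro!: sum.neutral)
      (simp add: sum.delta if_distrib cong: if_cong)
  have 2: "(\<Sum>i\<in>UNIV. axis i (h $ i)) = h" for h :: "real^'n^'m"
    by (simp add: vec_eq_iff axis_def sum_component if_distrib cong: if_cong)
  show ?thesis
    by (simp add: prod_eq_iff fst_sum snd_sum u_def v_def 1 2)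
qed

lemma k3_lattice_iff: "a \<in> k3_lattice \<longleftrightarrow> (\<forall>i k. fst a $ i $ k \<in> \<int>) \<and> (\<forall>j k. snd a $ j $ k \<in> \<int>)"
  by (cases a) (simp add: k3_lattice_def)

lemma k3_lattice_0: "0 \<in> k3_lattice"
  and k3_lattice_add: "a \<in> k3_lattice \<Longrightarrow> b \<in> k3_lattice \<Longrightarrow> a + b \<in> k3_lattice"
  and k3_lattice_diff: "a \<in> k3_lattice \<Longrightarrow> b \<in> k3_lattice \<Longrightarrow> a - b \<in> k3_lattice"
  and k3_lattice_minus: "a \<in> k3_lattice \<Longrightarrow> - a \<in> k3_lattice"
  and k3_lattice_scale: "a \<in> k3_lattice \<Longrightarrow> r \<in> \<int> \<Longrightarrow> r *\<^sub>R a \<in> k3_lattice"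
  by (auto simp: k3_lattice_iff)

lemma k3_lattice_sum: "(\<And>i. i \<in> A \<Longrightarrow> a i \<in> k3_lattice) \<Longrightarrow> (\<Sum>i\<in>A. a i) \<in> k3_lattice"
  by (induction A rule: infinite_finite_induct) (auto intro: k3_lattice_0 k3_lattice_add)

lemma u_in_k3_lattice: "u k i \<in> k3_lattice" and v_in_k3_lattice: "v l j \<in> k3_lattice"
  by (auto simp: k3_lattice_iff u_def v_def axis_def)

lemma standard_basis_cases:
  assumes "w \<in> standard_basis"
  obtains k i where "w = u k i" | k j where "w = v k j"
  using assms by (auto simp: standard_basis_def)

lemma standard_basis_subset: "standard_basis \<subseteq> k3_lattice"
  by (auto elim!: standard_basis_cases simp: u_in_k3_lattice v_in_k3_lattice)

lemma u_in_standard_basis: "u k i \<in> standard_basis" and v_in_standard_basis: "v l j \<in> standard_basis"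
  by (auto simp: standard_basis_def)

lemma span_standard_basis: "span standard_basis = UNIV"
proof -
  have "a \<in> span standard_basis" for a
    by (subst k3_vector_expansion)
      (intro span_add span_sum span_scale span_base u_in_standard_basis v_in_standard_basis)
  then show ?thesis by auto
qed

lemma k3_form_Ints:
  assumes "a \<in> k3_lattice" "b \<in> k3_lattice"
  shows "k3_form a b \<in> \<int>"
  using assms
  by (auto simp: k3_lattice_iff k3_form_def hyp_form_def neg_e8_form_def
      intro!: Ints_add Ints_sum Ints_mult)

text \<open>Pairings with the \<open>u k i\<close> are the hyperbolic coordinates, and
  \<open>e8_dual\<close> recovers the E8 coordinates from the pairings with the \<open>v k j\<close>
  by an integral matrix.\<close>

lemma k3_lattice_unimodular:
  assumes "\<And>b. b \<in> k3_lattice \<Longrightarrow> k3_form a b \<in> \<int>"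
  shows "a \<in> k3_lattice"
proof -
  have "fst a $ i $ k \<in> \<int>" for i k
    using assms[OF u_in_k3_lattice, of 1 i] assms[OF u_in_k3_lattice, of 2 i] exhaust_2[of k]
    by (auto simp: k3_form_u)
  moreover have "snd a $ j $ k \<in> \<int>" for j k
  proof -
    have "e8_dual (\<lambda>k. neg_e8_form (snd a $ j) (axis k 1)) $ k \<in> \<int>"
      using assms[OF v_in_k3_lattice] by (intro e8_dual_Ints) (simp add: k3_form_v)
    then show ?thesis by (simp add: e8_dual_neg_e8_form)
  qed
  ultimately show ?thesis by (simp add: k3_lattice_iff)
qed

lemma k3_form_nondegenerate:
  assumes "\<And>b. k3_form a b = 0"
  shows "a = 0"
proof -
  have "fst a $ i $ k = 0" for i k
    using assms[of "u 1 i"] assms[of "u 2 i"] exhaust_2[of k] by (auto simp: k3_form_u)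
  moreover have "snd a $ j = 0" for j
    using e8_dual_neg_e8_form[of "snd a $ j"] assms[of "v _ j"]
    by (simp add: k3_form_v e8_dual_def vec_eq_iff forall_8 vector_8)
  ultimately show ?thesis by (simp add: prod_eq_iff vec_eq_iff)
qed

section \<open>Linear independence, Gram matrix and dual vectors of the 19 node roots\<close>

section \<open>The nodes and their span\<close>

lemma node_exhaust:
  obtains i where "n = Inl i" | j k where "n = Inr (j, k)"
  by (cases n) (auto)

lemma node_root_in_k3_lattice: "node_root n \<in> k3_lattice"
  by (cases n rule: node_exhaust) (auto intro: k3_lattice_diff u_in_k3_lattice v_in_k3_lattice)

lemma sum_node: "(\<Sum>n\<in>UNIV. t n) = (\<Sum>i\<in>UNIV. t (Inl i)) + (\<Sum>j\<in>UNIV. \<Sum>k\<in>UNIV. t (Inr (j, k)))"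
  for t :: "node \<Rightarrow> 'a::comm_monoid_add"
  by (simp add: UNIV_Plus_UNIV[symmetric] sum.Plus sum.cartesian_product UNIV_Times_UNIV[symmetric]
      del: UNIV_Plus_UNIV UNIV_Times_UNIV)

lemma fst_sum_node_root:
  "fst (\<Sum>n\<in>UNIV. c n *\<^sub>R node_root n) $ i = c (Inl i) *\<^sub>R (axis 1 1 - axis 2 1)"
  using exhaust_3[of i]
  by (auto simp: sum_node fst_sum u_def v_def sum_3 axis_def vec_eq_iff)

lemma snd_sum_node_root: "snd (\<Sum>n\<in>UNIV. c n *\<^sub>R node_root n) $ j $ k = c (Inr (j, k))"
proof -
  have "snd (\<Sum>n\<in>UNIV. c n *\<^sub>R node_root n) $ j $ k =
      (\<Sum>j'\<in>UNIV. \<Sum>k'\<in>UNIV. c (Inr (j', k')) *\<^sub>R (axis j' (axis k' 1) $ j $ k))"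
    by (simp add: sum_node snd_sum u_def v_def sum_component)
  also have "\<dots> = (\<Sum>k'\<in>UNIV. c (Inr (j, k')) *\<^sub>R (axis k' 1 $ k))"
    using exhaust_2[of j] by (auto simp: sum_2 axis_def)
  also have "\<dots> = (\<Sum>k'\<in>UNIV. if k' = k then c (Inr (j, k')) else 0)"
    by (rule sum.cong) (auto simp: axis_def)
  finally show ?thesis by simp
qed

lemma node_root_sum_eq_0:
  assumes "(\<Sum>n\<in>UNIV. c n *\<^sub>R node_root n) = 0"
  shows "c n = 0"
proof (cases n rule: node_exhaust)
  case (1 i)
  then show ?thesis
    using fst_sum_node_root[of c i] assms by (auto simp: vec_eq_iff axis_def split: if_splits)
next
  case (2 j k)
  then show ?thesis
    using snd_sum_node_root[of c j k] assms by simp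
qed

lemma node_root_eq_scaleR_iff:
  assumes "node_root m = r *\<^sub>R node_root n"
  shows "m = n"
proof (rule ccontr)
  assume "m \<noteq> n"
  \<comment> \<open>The assumed proportionality, written as a linear relation among all node
    roots.\<close>
  define c where "c l = (if l = m then 1 else if l = n then - r else 0)" for l
  have "(\<Sum>l\<in>UNIV. c l *\<^sub>R node_root l) = (\<Sum>l\<in>{m, n}. c l *\<^sub>R node_root l)"
    by (rule sum.mono_neutral_right) (auto simp: c_def)
  also have "\<dots> = 0"
    using \<open>m \<noteq> n\<close> assms by (simp add: c_def)
  finally have "c m = 0" by (rule node_root_sum_eq_0)
  then show False by (simp add: c_def)
qed

text \<open>Guarantees that the description by \<open>THE\<close> in \<open>node_action\<close> has
  at most one solution.\<close>

lemma node_root_unique: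
  assumes "a = node_root m \<or> a = - node_root m" "a = node_root n \<or> a = - node_root n"
  shows "m = n"
proof -
  have "node_root m = 1 *\<^sub>R node_root n \<or> node_root m = (-1) *\<^sub>R node_root n"
    using assms by (metis add.inverse_inverse scaleR_one scaleR_minus1_left)
  then show ?thesis
    using node_root_eq_scaleR_iff by blast
qed

lemma inj_node_root: "inj node_root"
  by (rule injI) (rule node_root_unique, auto)

lemma independent_node_roots: "independent (range node_root)"
proof -
  have False if "r \<in> range node_root" "c r \<noteq> 0" "(\<Sum>r\<in>range node_root. c r *\<^sub>R r) = 0" for c r
  proof -
    have "(\<Sum>n\<in>UNIV. c (node_root n) *\<^sub>R node_root n) = 0"
      using that(3) by (simp add: sum.reindex[OF inj_node_root] o_def)
    then show False using that node_root_sum_eq_0[of "c \<circ> node_root"] by auto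
  qed
  then show ?thesis
    by (subst dependent_finite) (simp, blast)
qed

lemma node_root_form:
  "k3_form (node_root m) (node_root n) = (if m = n then - 2 else if node_edge m n then 1 else 0)"
proof -
  have "fst (v k j) = 0" "snd (u l i) = 0" for k j l i
    by (simp_all add: v_def u_def)
  moreover have "neg_e8_form 0 p = 0" for p
    by (simp add: neg_e8_form_def)
  ultimately show ?thesis
    by (cases m rule: node_exhaust; cases n rule: node_exhaust)
      (auto simp: k3_form_simps k3_form_u k3_form_v, auto simp: u_def v_def axis_def neg_e8_form_axis_axis[unfolded axis_def])
qed

text \<open>The A1 lattice is not unimodular, so \<open>\<theta>\<close> cannot be sought in the
  span of the nodes. In a hyperbolic plane the product of \<open>u 2 i\<close> with
  \<open>u 1 i - u 2 i\<close> is 1, so a multiple of \<open>u 2 i\<close> serves; in the E8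
  summands \<open>e8_dual\<close> does.\<close>

lemma node_dual_exists:
  fixes t :: "node \<Rightarrow> int"
  obtains \<theta> where "\<theta> \<in> k3_lattice" "\<And>n. k3_form \<theta> (node_root n) = of_int (t n)"
proof
  define \<theta> :: k3_space where
    "\<theta> = (\<chi> i. axis 2 (of_int (t (Inl i))), \<chi> j. e8_dual (\<lambda>k. of_int (t (Inr (j, k)))))"
  show "\<theta> \<in> k3_lattice"
    by (auto simp: \<theta>_def k3_lattice_iff axis_def intro: e8_dual_Ints)
  show "k3_form \<theta> (node_root n) = of_int (t n)" for n
    by (cases n rule: node_exhaust)
      (simp_all add: \<theta>_def k3_form_simps k3_form_u k3_form_v neg_e8_form_e8_dual, simp add: axis_def)
qed

section \<open>Structure of finite groups of exponent two, by maximal embeddings\<close>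

section \<open>Finite groups of exponent two\<close>

text \<open>An element \<open>x\<close> outside the image of an embedding is one more independent
  generator, since \<open>x\<close> has order two.\<close>

lemma (in comm_group) extend_elementary_2_group:
  assumes exponent: "\<And>x. x \<in> carrier G \<Longrightarrow> x \<otimes> x = \<one>"
    and h: "h \<in> hom (elementary_2_group n) G" "inj_on h (carrier (elementary_2_group n))"
    and x: "x \<in> carrier G" "x \<notin> h ` carrier (elementary_2_group n)"
  shows "\<exists>h' \<in> hom (elementary_2_group (Suc n)) G. inj_on h' (carrier (elementary_2_group (Suc n)))"
proof
  interpret E: group "elementary_2_group m" for m
    by simp
  interpret h: group_hom "elementary_2_group n" G h
    using h(1) by unfold_locales auto
  \<comment> \<open>The new bit \<open>c n\<close> decides whether \<open>x\<close> occurs as a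
    factor.\<close>
  define h' where "h' c = h (restrict c {..<n}) \<otimes> (if c n = 1 then x else \<one>)" for c :: "nat \<Rightarrow> int"
  have restrict: "restrict c {..<n} \<in> carrier (elementary_2_group n)"
    if "c \<in> carrier (elementary_2_group (Suc n))" for c
    using that by (auto simp: PiE_iff)
  have last: "c n = 0 \<or> c n = 1" if "c \<in> carrier (elementary_2_group (Suc n))" for c
  proof -
    have "c n \<in> {0..<2}"
      using that by (auto simp: PiE_iff carrier_integer_mod_group)
    then show ?thesis by auto
  qed
  have hc: "h (restrict c {..<n}) \<in> carrier G" if "c \<in> carrier (elementary_2_group (Suc n))" for c
    using restrict[OF that] h(1) by (rule hom_in_carrier[rotated])
  show hom: "h' \<in> hom (elementary_2_group (Suc n)) G"
  proof (rule homI)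
    fix c d
    assume c: "c \<in> carrier (elementary_2_group (Suc n))" and d: "d \<in> carrier (elementary_2_group (Suc n))"
    show "h' c \<in> carrier G"
      using hc[OF c] x by (simp add: h'_def)
    have "restrict (c \<otimes>\<^bsub>elementary_2_group (Suc n)\<^esub> d) {..<n} =
        restrict c {..<n} \<otimes>\<^bsub>elementary_2_group n\<^esub> restrict d {..<n}"
      by (auto simp: fun_eq_iff)
    then have "h (restrict (c \<otimes>\<^bsub>elementary_2_group (Suc n)\<^esub> d) {..<n}) =
        h (restrict c {..<n}) \<otimes> h (restrict d {..<n})"
      using hom_mult[OF h(1) restrict[OF c] restrict[OF d]] by simp
    \<comment> \<open>If both last bits are 1, their sum modulo 2 is 0, matching the product of
      \<open>x\<close> with itself being the unit.\<close>
    moreover have "(c \<otimes>\<^bsub>elementary_2_group (Suc n)\<^esub> d) n = (c n + d n) mod 2"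
      by simp
    ultimately show "h' (c \<otimes>\<^bsub>elementary_2_group (Suc n)\<^esub> d) = h' c \<otimes> h' d"
      using last[OF c] last[OF d] hc[OF c] hc[OF d] x exponent[OF x(1)]
      by (auto simp: h'_def m_ac simp del: mult_product_group)
  qed
  interpret h': group_hom "elementary_2_group (Suc n)" G h'
    using hom by unfold_locales auto
  show "inj_on h' (carrier (elementary_2_group (Suc n)))"
  proof (subst h'.inj_on_one_iff, intro allI impI)
    fix c
    assume c: "c \<in> carrier (elementary_2_group (Suc n))" and 1: "h' c = \<one>"
    \<comment> \<open>Otherwise \<open>x\<close> would be the inverse of an element of the image of
      \<open>h\<close>, and that inverse is the element itself.\<close>
    have "c n \<noteq> 1"
    proof
      assume "c n = 1"
      then have "h (restrict c {..<n}) \<otimes> x = \<one>"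
        using 1 by (simp add: h'_def)
      then have "x = inv (h (restrict c {..<n}))"
        using hc[OF c] x(1) by (metis inv_equality m_comm inv_inv)
      also have "\<dots> = h (restrict c {..<n})"
        using exponent[OF hc[OF c]] hc[OF c] by (simp add: inv_equality)
      finally show False
        using x(2) restrict[OF c] by blast
    qed
    then have cn: "c n = 0" using last[OF c] by simp
    then have "h (restrict c {..<n}) = h \<one>\<^bsub>elementary_2_group n\<^esub>"
      using 1 hc[OF c] h.hom_one by (simp add: h'_def)
    then have r: "restrict c {..<n} = \<one>\<^bsub>elementary_2_group n\<^esub>"
      using h(2) restrict[OF c] E.one_closed by (metis inj_onD)
    show "c = \<one>\<^bsub>elementary_2_group (Suc n)\<^esub>"
    proof
      fix k
      show "c k = \<one>\<^bsub>elementary_2_group (Suc n)\<^esub> k"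
        using fun_cong[OF r, of k] cn c
        by (cases k n rule: linorder_cases) (auto simp: PiE_iff extensional_def)
    qed
  qed
qed

lemma card_elementary_2_group: "card (carrier (elementary_2_group n)) = 2 ^ n"
  by (simp add: card_PiE carrier_integer_mod_group)

text \<open>The trivial embedding of rank 0 is extended as long as possible. The ranks are bounded
  because \<open>n < 2 ^ n\<close> and the group is finite, and an embedding that cannot be extended
  is onto.\<close>

lemma (in comm_group) iso_elementary_2_group:
  assumes "finite (carrier G)" and exponent: "\<And>x. x \<in> carrier G \<Longrightarrow> x \<otimes> x = \<one>"
  shows "\<exists>n. G \<cong> elementary_2_group n"
proof -
  define P where "P n \<longleftrightarrow> (\<exists>h \<in> hom (elementary_2_group n) G. inj_on h (carrier (elementary_2_group n)))" for n
  have "P 0"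
    unfolding P_def by (intro bexI[of _ "\<lambda>_. \<one>"] homI) auto
  moreover have "n \<le> card (carrier G)" if "P n" for n
  proof -
    obtain h where "h \<in> hom (elementary_2_group n) G" "inj_on h (carrier (elementary_2_group n))"
      using \<open>P n\<close> by (auto simp: P_def)
    then have "card (carrier (elementary_2_group n)) \<le> card (carrier G)"
      using assms(1) by (meson card_inj_on_le hom_carrier)
    then show ?thesis
      unfolding card_elementary_2_group using less_exp[of n] by linarith
  qed
  ultimately obtain n where n: "P n" "\<not> P (Suc n)"
    by (metis Suc_n_not_le_n nat_induct)
  then obtain h where h: "h \<in> hom (elementary_2_group n) G" "inj_on h (carrier (elementary_2_group n))"
    by (auto simp: P_def)
  have "carrier G \<subseteq> h ` carrier (elementary_2_group n)"
    using extend_elementary_2_group[OF exponent h] n(2) by (auto simp only: P_def)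
  then have "h ` carrier (elementary_2_group n) = carrier G"
    using hom_carrier[OF h(1)] by blast
  then have "h \<in> iso (elementary_2_group n) G"
    using h by (simp add: iso_def bij_betw_def)
  then have "elementary_2_group n \<cong> G"
    by (auto simp: is_iso_def)
  then show ?thesis
    using group.iso_sym[of "elementary_2_group n"] by auto
qed

section \<open>Gram-Schmidt orthogonalisation for the negative of the K3 form\<close>

section \<open>Orthogonal bases of definite subspaces\<close>

text \<open>Induction on the dimension: a nonzero vector \<open>a\<close> is split off and the
  induction hypothesis is applied to its orthogonal complement in \<open>U\<close>. Definiteness
  keeps \<open>a\<close> out of this complement, so the dimension drops.\<close>

lemma negative_definite_orthogonal_basis:
  fixes U :: "k3_space set"
  assumes "subspace U" "\<And>a. a \<in> U \<Longrightarrow> a \<noteq> 0 \<Longrightarrow> k3_form a a < 0"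
  shows "\<exists>Q. finite Q \<and> Q \<subseteq> U \<and> independent Q \<and> span Q = U \<and> 0 \<notin> Q
    \<and> (\<forall>a\<in>Q. \<forall>b\<in>Q. a \<noteq> b \<longrightarrow> k3_form a b = 0)"
  using assms
proof (induction "dim U" arbitrary: U rule: less_induct)
  case less
  show ?case
  proof (cases "U = {0}")
    case True
    then show ?thesis by (intro exI[of _ "{}"]) (auto simp: independent_empty)
  next
    case False
    then obtain a where a: "a \<in> U" "a \<noteq> 0"
      using subspace_0[OF less.prems(1)] by auto
    define U' where "U' = {b \<in> U. k3_form a b = 0}"
    have sub': "subspace U'"
      using less.prems(1) by (auto simp: U'_def subspace_def k3_form_simps)
    have aa: "k3_form a a < 0"
      using less.prems(2) a by auto
    then have "a \<notin> U'" by (simp add: U'_def)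
    then have "span U' \<subset> span U"
      using a sub' less.prems(1) by (auto simp: span_eq_iff[THEN iffD2] U'_def)
    then have "dim U' < dim U"
      by (rule dim_psubset)
    then obtain Q where Q: "finite Q" "Q \<subseteq> U'" "independent Q" "span Q = U'" "0 \<notin> Q"
      "\<forall>a\<in>Q. \<forall>b\<in>Q. a \<noteq> b \<longrightarrow> k3_form a b = 0"
      using less.hyps[of U'] sub' less.prems(2) by (auto simp: U'_def)
    have "span (insert a Q) = U"
    proof
      show "span (insert a Q) \<subseteq> U"
        using Q(2) a less.prems(1) by (intro span_minimal) (auto simp: U'_def)
      show "U \<subseteq> span (insert a Q)"
      proof
        fix b assume b: "b \<in> U"
        have "b - (k3_form a b / k3_form a a) *\<^sub>R a \<in> U'"
          using aa a b less.prems(1) by (auto simp: U'_def k3_form_simps subspace_diff subspace_scale)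
        then show "b \<in> span (insert a Q)"
          using Q(4) span_breakdown_eq by blast
      qed
    qed
    moreover have "independent (insert a Q)"
      using Q \<open>a \<notin> U'\<close> by (simp add: independent_insert)
    moreover have "\<forall>b\<in>Q. k3_form a b = 0 \<and> k3_form b a = 0"
      using Q(2) by (auto simp: U'_def k3_form_commute)
    moreover have "insert a Q \<subseteq> U"
      using Q(2) a by (auto simp: U'_def)
    ultimately show ?thesis
      using Q a by (intro exI[of _ "insert a Q"]) auto
  qed
qed

section \<open>Span, signature and discriminant group of a fixed lattice\<close>

section \<open>Fixed lattices of involutions\<close>

locale k3_involution =
  fixes f :: "k3_space \<Rightarrow> k3_space"
  assumes linear: "linear f"
    and form: "k3_form (f a) (f b) = k3_form a b"
    and lattice: "a \<in> k3_lattice \<Longrightarrow> f a \<in> k3_lattice"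
    and involution: "f (f a) = a"
begin

lemmas simps = linear_add[OF linear] linear_diff[OF linear] linear_scale[OF linear]
  linear_neg[OF linear] linear_0[OF linear] form involution

text \<open>As \<open>f\<close> is its own inverse, mapping the lattice into itself already means
  mapping it onto itself.\<close>

lemma isometry: "isometry f"
proof -
  have "k3_lattice \<subseteq> f ` k3_lattice"
    using lattice involution by (metis image_eqI subsetI)
  then show ?thesis
    using linear form lattice by (auto simp: isometry_def)
qed

text \<open>The map taking \<open>b\<close> to \<open>b + f b\<close> sends the standard basis into
  the fixed lattice, hence the whole space into its span; on fixed vectors it is multiplication by
  2.\<close>

lemma span_fixed_lattice: "span (fixed_lattice f) = {a. f a = a}"
proof
  show "span (fixed_lattice f) \<subseteq> {a. f a = a}"
    by (rule span_minimal) (auto simp: fixed_lattice_def subspace_def simps)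
  show "{a. f a = a} \<subseteq> span (fixed_lattice f)"
  proof
    fix a assume "a \<in> {a. f a = a}"
    have "linear (\<lambda>b. b + f b)"
      using linear by (intro linear_compose_add linear_ident)
    then have "span ((\<lambda>b. b + f b) ` standard_basis) = range (\<lambda>b. b + f b)"
      by (simp add: linear_span_image span_standard_basis)
    moreover have "b + f b \<in> fixed_lattice f" if "b \<in> standard_basis" for b
    proof -
      have "b \<in> k3_lattice"
        using that standard_basis_subset by blast
      then show ?thesis
        using k3_lattice_add[OF _ lattice] by (simp add: fixed_lattice_def simps add.commute)
    qed
    then have "(\<lambda>b. b + f b) ` standard_basis \<subseteq> fixed_lattice f"
      by blast
    ultimately have "a + f a \<in> span (fixed_lattice f)"
      using span_mono by blast
    then have "(1/2) *\<^sub>R (a + f a) \<in> span (fixed_lattice f)"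
      by (rule span_scale)
    moreover have "a = (1/2) *\<^sub>R (a + f a)"
      using \<open>a \<in> _\<close> by (simp flip: scaleR_2)
    ultimately show "a \<in> span (fixed_lattice f)" by simp
  qed
qed

text \<open>The vector \<open>z\<close> carries the positive direction; its complement among the
  fixed vectors is negative definite by \<open>neg\<close> and has an orthogonal basis.\<close>

lemma hyperbolic_fixed_lattice:
  assumes z: "f z = z" "k3_form z z > 0"
    and neg: "\<And>a. f a = a \<Longrightarrow> k3_form z a = 0 \<Longrightarrow> a \<noteq> 0 \<Longrightarrow> k3_form a a < 0"
  shows "hyperbolic (fixed_lattice f)"
proof -
  define U where "U = {a. f a = a \<and> k3_form z a = 0}"
  have "subspace U"
    by (auto simp: U_def subspace_def simps k3_form_simps)
  then obtain Q where Q: "finite Q" "Q \<subseteq> U" "independent Q" "span Q = U" "0 \<notin> Q"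
    "\<forall>a\<in>Q. \<forall>b\<in>Q. a \<noteq> b \<longrightarrow> k3_form a b = 0"
    using negative_definite_orthogonal_basis[of U] neg by (auto simp: U_def)
  have zU: "z \<notin> U"
    using z by (auto simp: U_def)
  then have zQ: "z \<notin> Q" using Q(2) by auto
  have "span (insert z Q) = {a. f a = a}"
  proof
    show "span (insert z Q) \<subseteq> {a. f a = a}"
      using z Q(2) by (intro span_minimal) (auto simp: U_def subspace_def simps)
    show "{a. f a = a} \<subseteq> span (insert z Q)"
    proof
      fix b assume b: "b \<in> {a. f a = a}"
      have "b - (k3_form z b / k3_form z z) *\<^sub>R z \<in> U"
        using z b by (auto simp: U_def k3_form_simps simps)
      then show "b \<in> span (insert z Q)"
        using Q(4) span_breakdown_eq by blast
    qed
  qed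
  then have "span ({z} \<union> Q) = span (fixed_lattice f)"
    by (simp add: span_fixed_lattice)
  moreover have "independent ({z} \<union> Q)"
    using Q zU by (simp add: independent_insert)
  moreover have "\<forall>a\<in>Q. k3_form z a = 0 \<and> k3_form a z = 0"
    using Q(2) by (auto simp: U_def k3_form_commute)
  moreover have "\<forall>a\<in>Q. k3_form a a < 0"
  proof
    fix a assume "a \<in> Q"
    then have "a \<in> U" "a \<noteq> 0"
      using Q(2,5) by blast+
    then show "k3_form a a < 0"
      using neg by (simp add: U_def)
  qed
  ultimately have "has_signature (fixed_lattice f) 1 (card Q)"
    unfolding has_signature_def
    using Q z zQ by (intro exI[of _ "{z}"] exI[of _ Q]) auto
  then show ?thesis by (auto simp: hyperbolic_def)
qed

lemma double_dual_lattice: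
  assumes "a \<in> dual_lattice (fixed_lattice f)"
  shows "a + a \<in> fixed_lattice f"
proof -
  have fa: "f a = a"
    using assms span_fixed_lattice by (auto simp: dual_lattice_def)
  have "k3_form (a + a) b \<in> \<int>" if b: "b \<in> k3_lattice" for b
  proof -
    have "b + f b \<in> fixed_lattice f"
      using k3_lattice_add[OF b lattice[OF b]] by (simp add: fixed_lattice_def simps add.commute)
    then have "k3_form a (b + f b) \<in> \<int>"
      using assms by (auto simp: dual_lattice_def)
    moreover have "k3_form a (f b) = k3_form a b"
      using form[of a b] fa by simp
    ultimately show ?thesis by (simp add: k3_form_simps)
  qed
  then have "a + a \<in> k3_lattice"
    by (rule k3_lattice_unimodular)
  then show ?thesis
    using fa by (simp add: fixed_lattice_def simps)
qed

text \<open>A class of the discriminant group is determined by the parities of the coordinates of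
  twice a representative.\<close>

lemma two_elementary_fixed_lattice: "two_elementary (fixed_lattice f)"
proof -
  define N where "N = fixed_lattice f"
  define D where "D = \<lparr>carrier = dual_lattice N, mult = (+), one = 0 :: k3_space\<rparr>"
  have span: "a \<in> span N \<longleftrightarrow> f a = a" for a
    by (simp add: N_def span_fixed_lattice)
  interpret D: comm_group D
  proof (rule comm_groupI)
    fix a assume "a \<in> carrier D"
    then have "- a \<in> carrier D"
      by (simp add: D_def dual_lattice_def span k3_form_simps simps)
    then show "\<exists>b\<in>carrier D. b \<otimes>\<^bsub>D\<^esub> a = \<one>\<^bsub>D\<^esub>"
      by (auto simp: D_def intro!: bexI[of _ "- a"])
  qed (auto simp: D_def dual_lattice_def span k3_form_simps simps)
  have N_dual: "N \<subseteq> dual_lattice N"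
    by (auto simp: dual_lattice_def span_base N_def fixed_lattice_def intro: k3_form_Ints)
  have inv_D: "inv\<^bsub>D\<^esub> a = - a" if "a \<in> carrier D" for a
    using that
    by (intro D.inv_equality) (auto simp: D_def dual_lattice_def span k3_form_simps simps)
  have subgroup: "subgroup N D"
  proof (rule D.subgroupI)
    show "N \<subseteq> carrier D" using N_dual by (simp add: D_def)
    show "N \<noteq> {}"
    proof -
      have "0 \<in> N"
        using k3_lattice_0 by (simp add: N_def fixed_lattice_def simps)
      then show ?thesis by blast
    qed
    show "inv\<^bsub>D\<^esub> a \<in> N" if "a \<in> N" for a
      using that N_dual by (subst inv_D)
        (auto simp: D_def N_def fixed_lattice_def simps intro: k3_lattice_minus)
  qed (auto simp: D_def N_def fixed_lattice_def simps intro: k3_lattice_add)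
  then interpret N: normal N D
    by (rule D.subgroup_imp_normal)
  interpret Q: comm_group "D Mod N"
    by (rule D.abelian_FactGroup[OF subgroup])
  \<comment> \<open>For a dual vector the doubled coordinates are integers by
    \<open>double_dual_lattice\<close>, so the floors are exact there.\<close>
  define parity where "parity a =
    ({(i, k). even \<lfloor>2 * fst a $ i $ k\<rfloor>}, {(j, k). even \<lfloor>2 * snd a $ j $ k\<rfloor>})" for a :: k3_space
  have halves: "x - y \<in> \<int>" if "2 * x \<in> \<int>" "2 * y \<in> \<int>" "even \<lfloor>2 * x\<rfloor> = even \<lfloor>2 * y\<rfloor>" for x y :: real
  proof -
    have "even (\<lfloor>2 * x\<rfloor> - \<lfloor>2 * y\<rfloor>)"
      using that(3) by simp
    then obtain m where "\<lfloor>2 * x\<rfloor> - \<lfloor>2 * y\<rfloor> = 2 * m" ..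
    then have "2 * x - 2 * y = 2 * of_int m"
      using that(1,2) by (metis (no_types) of_int_diff of_int_floor of_int_mult of_int_numeral)
    then have "x - y = of_int m" by simp
    then show ?thesis by simp
  qed
  have coset_eq: "N #>\<^bsub>D\<^esub> a = N #>\<^bsub>D\<^esub> b"
    if a: "a \<in> carrier D" and b: "b \<in> carrier D" and eq: "parity a = parity b" for a b
  proof -
    have a2: "a + a \<in> k3_lattice" and b2: "b + b \<in> k3_lattice"
      using a b double_dual_lattice[of a] double_dual_lattice[of b]
      by (auto simp: D_def N_def fixed_lattice_def)
    have "fst (a - b) $ i $ k \<in> \<int>" for i k
      using halves[of "fst a $ i $ k" "fst b $ i $ k"] a2 b2 eq
      by (auto simp: k3_lattice_iff parity_def set_eq_iff simp flip: mult_2)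
    moreover have "snd (a - b) $ j $ k \<in> \<int>" for j k
      using halves[of "snd a $ j $ k" "snd b $ j $ k"] a2 b2 eq
      by (auto simp: k3_lattice_iff parity_def set_eq_iff simp flip: mult_2)
    ultimately have "a - b \<in> k3_lattice"
      by (simp add: k3_lattice_iff)
    then have "a - b \<in> N"
      using a b span[of a] span[of b] by (simp add: D_def dual_lattice_def N_def fixed_lattice_def simps)
    then have "a \<in> N #>\<^bsub>D\<^esub> b"
      by (auto simp: r_coset_def D_def intro!: bexI[of _ "a - b"])
    then show ?thesis
      using D.repr_independence[OF _ b subgroup] by simp
  qed
  \<comment> \<open>The values are pairs of subsets of finite index types, so there are finitely
    many of them; choosing a representative for each value then bounds the number of cosets.\<close>
  have "finite (range parity)"
    by (rule finite_subset[OF subset_UNIV]) simp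
  have "rcosets\<^bsub>D\<^esub> N \<subseteq> (\<lambda>s. N #>\<^bsub>D\<^esub> (SOME a. a \<in> carrier D \<and> parity a = s)) ` range parity"
  proof
    fix K assume "K \<in> rcosets\<^bsub>D\<^esub> N"
    then obtain a where a: "a \<in> carrier D" "K = N #>\<^bsub>D\<^esub> a"
      by (auto simp: RCOSETS_def)
    define b where "b = (SOME b. b \<in> carrier D \<and> parity b = parity a)"
    have "b \<in> carrier D \<and> parity b = parity a"
      unfolding b_def by (rule someI[of _ a]) (use a in auto)
    then have "K = N #>\<^bsub>D\<^esub> b"
      using a coset_eq by metis
    then show "K \<in> (\<lambda>s. N #>\<^bsub>D\<^esub> (SOME a. a \<in> carrier D \<and> parity a = s)) ` range parity"
      by (auto simp: b_def)
  qed
  then have "finite (carrier (D Mod N))"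
    using \<open>finite (range parity)\<close> by (simp add: FactGroup_def finite_subset)
  moreover have "K \<otimes>\<^bsub>D Mod N\<^esub> K = \<one>\<^bsub>D Mod N\<^esub>" if "K \<in> carrier (D Mod N)" for K
  proof -
    obtain a where a: "a \<in> carrier D" "K = N #>\<^bsub>D\<^esub> a"
      using \<open>K \<in> _\<close> by (auto simp: FactGroup_def RCOSETS_def)
    \<comment> \<open>Doubling a dual vector leads into the fixed lattice, so the quotient has
      exponent two.\<close>
    have "a \<otimes>\<^bsub>D\<^esub> a \<in> N"
      using a double_dual_lattice[of a] by (simp add: D_def N_def)
    then have "N #>\<^bsub>D\<^esub> (a \<otimes>\<^bsub>D\<^esub> a) = N"
      using a by (intro D.coset_join2 subgroup) auto
    then show ?thesis
      using a by (simp add: FactGroup_def N.rcos_sum)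
  qed
  ultimately have "\<exists>n. D Mod N \<cong> elementary_2_group n"
    by (rule Q.iso_elementary_2_group)
  then show ?thesis
    by (simp add: two_elementary_def discriminant_group_def D_def N_def)
qed

end

section \<open>Roots in the span of the nodes and the Dynkin diagrams they give\<close>

section \<open>The root space\<close>

text \<open>The orthogonal complement of the three vectors \<open>u 1 i + u 2 i\<close>, which is
  the span of the node roots.\<close>

definition root_space :: "k3_space set" where
  "root_space = {a. \<forall>i. fst a $ i $ 1 + fst a $ i $ 2 = 0}"

text \<open>Defined on the whole space, but the coefficient of a node root only for vectors of
  \<open>root_space\<close>, whose two coordinates in each hyperbolic plane are opposite.\<close>

definition node_coeff :: "k3_space \<Rightarrow> node \<Rightarrow> real" where
  "node_coeff a n = (case n of Inl i \<Rightarrow> fst a $ i $ 1 | Inr (j, k) \<Rightarrow> snd a $ j $ k)"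

text \<open>The type \<open>3 + 2\<close> indexes the connected components of the diagram: three of
  type A1 and two of type E8.\<close>

definition node_component :: "node \<Rightarrow> 3 + 2" where
  "node_component = map_sum id fst"

lemma node_component_simps [simp]:
  "node_component (Inl i) = Inl i" "node_component (Inr (j, k)) = Inr j"
  by (simp_all add: node_component_def)

lemma node_coeff_sum: "node_coeff (\<Sum>n\<in>UNIV. c n *\<^sub>R node_root n) n = c n"
  by (cases n rule: node_exhaust)
    (simp_all add: node_coeff_def fst_sum_node_root snd_sum_node_root, simp add: axis_def)

lemma sum_node_root_in_root_space: "(\<Sum>n\<in>UNIV. c n *\<^sub>R node_root n) \<in> root_space"
  by (simp add: root_space_def fst_sum_node_root axis_def)

lemma root_space_expansion:
  assumes "a \<in> root_space"
  shows "a = (\<Sum>n\<in>UNIV. node_coeff a n *\<^sub>R node_root n)"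
proof -
  have "fst a $ i $ 2 = - fst a $ i $ 1" for i
    using assms by (auto simp: root_space_def eq_neg_iff_add_eq_0 add.commute)
  then have "fst a = fst (\<Sum>n\<in>UNIV. node_coeff a n *\<^sub>R node_root n)"
    by (simp add: vec_eq_iff fst_sum_node_root forall_2 axis_def node_coeff_def)
  moreover have "snd a = snd (\<Sum>n\<in>UNIV. node_coeff a n *\<^sub>R node_root n)"
    by (simp add: vec_eq_iff snd_sum_node_root node_coeff_def)
  ultimately show ?thesis by (simp add: prod_eq_iff)
qed

lemma node_coeff_Ints: "a \<in> k3_lattice \<Longrightarrow> node_coeff a n \<in> \<int>"
  by (cases n rule: node_exhaust) (auto simp: node_coeff_def k3_lattice_iff)

definition component_form :: "k3_space \<Rightarrow> 3 + 2 \<Rightarrow> real" where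
  "component_form a C = (case C of Inl i \<Rightarrow> - 2 * (fst a $ i $ 1)\<^sup>2
     | Inr j \<Rightarrow> neg_e8_form (snd a $ j) (snd a $ j))"

lemma k3_form_root_space:
  assumes "a \<in> root_space"
  shows "k3_form a a = (\<Sum>C\<in>UNIV. component_form a C)"
proof -
  have "fst a $ i $ 2 = - fst a $ i $ 1" for i
    using assms by (auto simp: root_space_def eq_neg_iff_add_eq_0 add.commute)
  then show ?thesis
    by (simp add: k3_form_def component_form_def hyp_form_def power2_eq_square
        UNIV_Plus_UNIV[symmetric] sum.Plus del: UNIV_Plus_UNIV)
qed

lemma sum_nonpos_eq_0:
  fixes t :: "'a \<Rightarrow> 'b::linordered_idom"
  assumes "finite A" "\<And>x. x \<in> A \<Longrightarrow> t x \<le> 0" "(\<Sum>x\<in>A. t x) = 0" "x \<in> A"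
  shows "t x = 0"
proof -
  have "(\<Sum>x\<in>A. - t x) = 0"
    using assms(3) by (simp add: sum_negf)
  then have "\<forall>x\<in>A. - t x = 0"
    using assms(1,2) by (subst (asm) sum_nonneg_eq_0_iff) auto
  then show ?thesis using assms(4) by simp
qed

lemma component_form_nonpos: "component_form a C \<le> 0"
  by (cases C) (auto simp: component_form_def neg_e8_form_nonpos)

lemma component_form_eq_0:
  assumes "component_form a (node_component n) = 0"
  shows "node_coeff a n = 0"
  using assms
  by (cases n rule: node_exhaust) (auto simp: component_form_def node_coeff_def neg_e8_form_eq_0_iff)

text \<open>The square is a sum of nonpositive squares of the component parts, and each of these
  vanishes only if its part does.\<close>

lemma root_space_negative_definite:
  assumes "a \<in> root_space" "a \<noteq> 0"
  shows "k3_form a a < 0"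
proof (rule ccontr)
  assume "\<not> k3_form a a < 0"
  then have "(\<Sum>C\<in>UNIV. component_form a C) = 0"
    using assms(1) sum_nonpos[of UNIV "component_form a"] component_form_nonpos
    by (simp add: k3_form_root_space order_antisym)
  then have "component_form a C = 0" for C
    by (rule sum_nonpos_eq_0[rotated 2]) (simp_all add: component_form_nonpos)
  then have "a = 0"
    using root_space_expansion[OF assms(1)] component_form_eq_0 by simp
  then show False using assms(2) by simp
qed

lemma component_form_even:
  assumes "a \<in> k3_lattice"
  shows "\<exists>m::int. component_form a C = 2 * of_int m"
proof (cases C)
  case (Inl i)
  obtain m where "fst a $ i $ 1 = of_int m"
    using assms by (meson Ints_cases k3_lattice_iff)
  then show ?thesis
    using Inl by (intro exI[of _ "- (m\<^sup>2)"]) (simp add: component_form_def)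
next
  case (Inr j)
  then show ?thesis
    using assms neg_e8_form_even[of "snd a $ j"] by (simp add: component_form_def k3_lattice_iff)
qed

text \<open>A negative even integer is at most -2. This gap is what makes the positive or the
  negative part of a root vanish.\<close>

lemma root_space_form_le:
  assumes "a \<in> root_space" "a \<in> k3_lattice" "a \<noteq> 0"
  shows "k3_form a a \<le> - 2"
proof -
  obtain m :: "3 + 2 \<Rightarrow> int" where m: "\<And>C. component_form a C = 2 * of_int (m C)"
    using component_form_even[OF assms(2)] by metis
  have "k3_form a a = 2 * of_int (\<Sum>C\<in>UNIV. m C)"
    using k3_form_root_space[OF assms(1)] by (simp add: m sum_distrib_left)
  moreover have "k3_form a a < 0"
    using root_space_negative_definite assms by blast
  ultimately have "(\<Sum>C\<in>UNIV. m C) \<le> - 1" by linarith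
  then show ?thesis
    using \<open>k3_form a a = 2 * of_int (\<Sum>C\<in>UNIV. m C)\<close> by linarith
qed

text \<open>Halving the component squares gives nonpositive integers with sum -1, so only one of
  them is nonzero.\<close>

lemma root_supported_in_component:
  assumes "d \<in> root_space" "d \<in> k3_lattice" "k3_form d d = - 2"
  obtains C where "\<And>n. node_component n \<noteq> C \<Longrightarrow> node_coeff d n = 0"
proof -
  obtain m :: "3 + 2 \<Rightarrow> int" where m: "\<And>C. component_form d C = 2 * of_int (m C)"
    using component_form_even[OF assms(2)] by metis
  have nonpos: "m C \<le> 0" for C
    using component_form_nonpos[of d C] by (simp add: m)
  have "2 * real_of_int (\<Sum>C\<in>UNIV. m C) = - 2"
    using k3_form_root_space[OF assms(1)] assms(3) by (simp add: m sum_distrib_left)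
  then have sum: "(\<Sum>C\<in>UNIV. m C) = - 1" by linarith
  then obtain C where C: "m C \<noteq> 0"
    by (metis sum.neutral zero_neq_neg_one)
  have "(\<Sum>C'\<in>UNIV - {C}. m C') = - 1 - m C"
    using sum sum.remove[of UNIV C m] by simp
  then have "(\<Sum>C'\<in>UNIV - {C}. m C') = 0"
    using C nonpos[of C] sum_nonpos[of "UNIV - {C}" m, OF nonpos] by linarith
  then have zero: "m C' = 0" if "C' \<noteq> C" for C'
    by (rule sum_nonpos_eq_0[rotated 2]) (use that nonpos in auto)
  show thesis
  proof (rule that)
    fix n assume "node_component n \<noteq> C"
    then show "node_coeff d n = 0"
      using zero m component_form_eq_0 by simp
  qed
qed

text \<open>A root \<open>d = p - q\<close> with \<open>p, q\<close> the positive and negative parts has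
  \<open>-2 = p\<^sup>2 + q\<^sup>2 - 2 p q\<close> with \<open>p q \<ge> 0\<close>, and nonzero lattice vectors of the root space have
  square at most \<open>-2\<close>; so \<open>p\<close> or \<open>q\<close> vanishes.\<close>

lemma root_coeffs_same_sign:
  assumes "d \<in> root_space" "d \<in> k3_lattice" "k3_form d d = - 2"
  obtains \<epsilon> :: real and c :: "node \<Rightarrow> nat"
  where "\<epsilon> \<in> {1, -1}" "\<And>n. node_coeff d n = \<epsilon> * real (c n)"
proof -
  define pos where "pos n = max (node_coeff d n) 0" for n
  define neg where "neg n = max (- node_coeff d n) 0" for n
  define p where "p = (\<Sum>n\<in>UNIV. pos n *\<^sub>R node_root n)"
  define q where "q = (\<Sum>n\<in>UNIV. neg n *\<^sub>R node_root n)"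
  have "node_coeff d n = pos n - neg n" for n
    by (auto simp: pos_def neg_def)
  then have d: "d = p - q"
    using root_space_expansion[OF assms(1)]
    by (simp add: p_def q_def scaleR_diff_left sum_subtractf)
  have "pos n \<in> \<int>" "neg n \<in> \<int>" for n
    using node_coeff_Ints[OF assms(2), of n] by (auto simp: pos_def neg_def max_def)
  then have lat: "p \<in> k3_lattice" "q \<in> k3_lattice"
    by (auto simp: p_def q_def intro!: k3_lattice_sum k3_lattice_scale node_root_in_k3_lattice)
  \<comment> \<open>For \<open>m = n\<close> one of the two factors is 0, so the diagonal entries -2
    do not enter; all other entries are 0 or 1.\<close>
  have "pos m * neg n * k3_form (node_root n) (node_root m) \<ge> 0" for m n
    by (cases "m = n") (auto simp: pos_def neg_def node_root_form max_def)
  then have "(\<Sum>m\<in>UNIV. \<Sum>n\<in>UNIV. pos m * neg n * k3_form (node_root n) (node_root m)) \<ge> 0"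
    by (intro sum_nonneg)
  also have "(\<Sum>m\<in>UNIV. \<Sum>n\<in>UNIV. pos m * neg n * k3_form (node_root n) (node_root m)) = k3_form p q"
  proof -
    have "k3_form p q = (\<Sum>m\<in>UNIV. pos m * k3_form q (node_root m))"
      by (simp only: p_def k3_form_sum_left k3_form_simps k3_form_commute[of q]) simp
    then show ?thesis
      by (simp add: q_def k3_form_sum_left k3_form_simps sum_distrib_left mult.assoc)
  qed
  finally have pq: "k3_form p q \<ge> 0" .
  have "k3_form d d = k3_form p p + k3_form q q - 2 * k3_form p q"
    by (simp add: d k3_form_simps k3_form_commute[of q p])
  then have "k3_form p p + k3_form q q \<ge> - 2"
    using assms(3) pq by simp
  moreover have "p \<noteq> 0 \<Longrightarrow> k3_form p p \<le> - 2" "q \<noteq> 0 \<Longrightarrow> k3_form q q \<le> - 2"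
    using root_space_form_le lat by (auto simp: p_def q_def sum_node_root_in_root_space)
  ultimately have zero: "p = 0 \<or> q = 0" by fastforce
  have floor: "node_coeff d n = of_int \<lfloor>node_coeff d n\<rfloor>" for n
    using node_coeff_Ints[OF assms(2), of n] by (simp add: of_int_floor)
  from zero show thesis
  proof
    assume "p = 0"
    then have "pos n = 0" for n
      using node_root_sum_eq_0 by (auto simp: p_def)
    then have nonpos: "node_coeff d n \<le> 0" for n
      using max.cobounded1[of "node_coeff d n" 0] by (metis pos_def)
    have "node_coeff d n = - 1 * real (nat (- \<lfloor>node_coeff d n\<rfloor>))" for n
      using floor[of n] nonpos[of n] by linarith
    then show thesis by (intro that[of "- 1"]) auto
  next
    assume "q = 0"
    then have "neg n = 0" for n
      using node_root_sum_eq_0 by (auto simp: q_def)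
    then have nonneg: "node_coeff d n \<ge> 0" for n
      using max.cobounded1[of "- node_coeff d n" 0] by (metis neg_def neg_le_0_iff_le)
    have "node_coeff d n = 1 * real (nat \<lfloor>node_coeff d n\<rfloor>)" for n
      using floor[of n] nonneg[of n] by linarith
    then show thesis by (intro that[of 1]) auto
  qed
qed

text \<open>Having coefficients of a single sign is inherited by the roots supported outside
  \<open>M\<close>, so the remaining nodes are simple roots for them. The empty \<open>M\<close>
  gives the diagram of \<open>S\<close>, the general one that of \<open>S'\<close>.\<close>

lemma dynkin_labelling_node_root:
  assumes D: "\<And>d. d \<in> D \<longleftrightarrow> d \<in> k3_lattice \<and> k3_form d d = - 2 \<and> d \<in> root_space
    \<and> (\<forall>n\<in>M. node_coeff d n = 0)"
  shows "dynkin_labelling D (UNIV - M) node_edge node_root"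
proof -
  have root: "node_root n = (\<Sum>m\<in>UNIV. (if m = n then 1 else 0) *\<^sub>R node_root m)" for n
    by (simp add: if_distrib[of "\<lambda>r. r *\<^sub>R _"] cong: if_cong)
  have "node_root n \<in> root_space" for n
    by (subst root) (rule sum_node_root_in_root_space)
  moreover have "node_coeff (node_root n) m = (if m = n then 1 else 0)" for m n
    by (subst root) (rule node_coeff_sum)
  ultimately have "node_root ` (UNIV - M) \<subseteq> D"
    by (auto simp: D node_root_in_k3_lattice node_root_form)
  moreover have "\<exists>c :: node \<Rightarrow> nat. d = (\<Sum>n\<in>UNIV - M. real (c n) *\<^sub>R node_root n)
      \<or> d = - (\<Sum>n\<in>UNIV - M. real (c n) *\<^sub>R node_root n)" if "d \<in> D" for d
  proof -
    obtain \<epsilon> and c :: "node \<Rightarrow> nat"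
      where \<epsilon>: "\<epsilon> \<in> {1, -1}" and c: "\<And>n. node_coeff d n = \<epsilon> * real (c n)"
      using root_coeffs_same_sign \<open>d \<in> D\<close> D by metis
    have "d = (\<Sum>n\<in>UNIV. node_coeff d n *\<^sub>R node_root n)"
      using \<open>d \<in> D\<close> D root_space_expansion by blast
    also have "\<dots> = (\<Sum>n\<in>UNIV - M. node_coeff d n *\<^sub>R node_root n)"
      using \<open>d \<in> D\<close> D by (intro sum.mono_neutral_right) auto
    also have "\<dots> = \<epsilon> *\<^sub>R (\<Sum>n\<in>UNIV - M. real (c n) *\<^sub>R node_root n)"
      by (simp add: c scaleR_sum_right)
    finally show ?thesis using \<epsilon> by auto
  qed
  ultimately show ?thesis
    unfolding dynkin_labelling_def
    using inj_node_root independent_mono[OF independent_node_roots, of "node_root ` (UNIV - M)"]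
    by (auto simp: node_root_form intro: inj_on_subset)
qed

section \<open>Signed permutations of the summands and their action on the nodes\<close>

section \<open>Block isometries\<close>

text \<open>The sign depends on the component alone, and \<open>q\<close> moves entire E8 copies
  while keeping the positions inside them. Thus a root supported in one component is moved with one
  sign into one component. The property passes to products, so it holds on the whole generated
  group.\<close>

definition block_isometry :: "(k3_space \<Rightarrow> k3_space) \<Rightarrow> bool" where
  "block_isometry f \<longleftrightarrow> linear f \<and> (\<forall>a b. k3_form (f a) (f b) = k3_form a b)
     \<and> (\<forall>w\<in>standard_basis. f w \<in> standard_basis \<or> - f w \<in> standard_basis)
     \<and> (\<exists>p q \<epsilon>. \<forall>n. \<epsilon> (node_component n) \<in> {1, -1 :: real}
          \<and> f (node_root n) = \<epsilon> (node_component n) *\<^sub>R node_root (map_sum p (map_prod q id) n))"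

lemma node_component_map: "node_component (map_sum p (map_prod q id) n) = map_sum p q (node_component n)"
  by (cases n rule: node_exhaust) simp_all

lemma block_isometry_id: "block_isometry id"
  unfolding block_isometry_def
  by (intro conjI exI[of _ id] exI[of _ "\<lambda>_. 1"]) (auto simp: sum.map_id0 prod.map_id0 intro: linearI)

lemma
  assumes "block_isometry f"
  shows block_isometry_linear: "linear f"
    and block_isometry_form: "k3_form (f a) (f b) = k3_form a b"
    and block_isometry_standard_basis: "w \<in> standard_basis \<Longrightarrow> f w \<in> standard_basis \<or> - f w \<in> standard_basis"
  using assms unfolding block_isometry_def by blast+

lemma block_isometry_node_root:
  assumes "block_isometry f"
  obtains p q \<epsilon> where "\<And>n. \<epsilon> (node_component n) \<in> {1, -1 :: real}"
    "\<And>n. f (node_root n) = \<epsilon> (node_component n) *\<^sub>R node_root (map_sum p (map_prod q id) n)"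
  using assms unfolding block_isometry_def by blast

lemma block_isometry_comp:
  assumes f: "block_isometry f" and g: "block_isometry g"
  shows "block_isometry (f \<circ> g)"
proof -
  have lin: "linear f" "linear g"
    using f g by (simp_all add: block_isometry_linear)
  obtain p q \<epsilon> where f': "\<And>n. \<epsilon> (node_component n) \<in> {1, -1 :: real}"
    "\<And>n. f (node_root n) = \<epsilon> (node_component n) *\<^sub>R node_root (map_sum p (map_prod q id) n)"
    using f by (rule block_isometry_node_root) blast
  obtain p' q' \<epsilon>' where g': "\<And>n. \<epsilon>' (node_component n) \<in> {1, -1 :: real}"
    "\<And>n. g (node_root n) = \<epsilon>' (node_component n) *\<^sub>R node_root (map_sum p' (map_prod q' id) n)"
    using g by (rule block_isometry_node_root) blast
  \<comment> \<open>The sign of the product at a component is the sign of \<open>g\<close> there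
    times the sign of \<open>f\<close> at the image component.\<close>
  have "\<forall>n. \<epsilon>' (node_component n) * \<epsilon> (map_sum p' q' (node_component n)) \<in> {1, -1}
      \<and> (f \<circ> g) (node_root n) = (\<epsilon>' (node_component n) * \<epsilon> (map_sum p' q' (node_component n))) *\<^sub>R
        node_root (map_sum (p \<circ> p') (map_prod (q \<circ> q') id) n)"
  proof
    fix n :: node
    have "map_sum p (map_prod q id) (map_sum p' (map_prod q' id) n) = map_sum (p \<circ> p') (map_prod (q \<circ> q') id) n"
      by (cases n rule: node_exhaust) simp_all
    then show "\<epsilon>' (node_component n) * \<epsilon> (map_sum p' q' (node_component n)) \<in> {1, -1}
      \<and> (f \<circ> g) (node_root n) = (\<epsilon>' (node_component n) * \<epsilon> (map_sum p' q' (node_component n))) *\<^sub>R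
        node_root (map_sum (p \<circ> p') (map_prod (q \<circ> q') id) n)"
      using g'(1)[of n] f'(1)[of "map_sum p' (map_prod q' id) n"]
      by (auto simp: g'(2) f'(2) linear_scale[OF lin(1)] node_component_map)
  qed
  then have "\<exists>p q \<epsilon>. \<forall>n. \<epsilon> (node_component n) \<in> {1, -1 :: real}
      \<and> (f \<circ> g) (node_root n) = \<epsilon> (node_component n) *\<^sub>R node_root (map_sum p (map_prod q id) n)"
    by (intro exI[of _ "p \<circ> p'"] exI[of _ "q \<circ> q'"] exI[of _ "\<lambda>C. \<epsilon>' C * \<epsilon> (map_sum p' q' C)"])
  moreover have "(f \<circ> g) w \<in> standard_basis \<or> - (f \<circ> g) w \<in> standard_basis" if "w \<in> standard_basis" for w
  proof -
    show ?thesis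
      using block_isometry_standard_basis[OF g that] block_isometry_standard_basis[OF f, of "g w"]
        block_isometry_standard_basis[OF f, of "- g w"] by (auto simp: linear_neg[OF lin(1)])
  qed
  ultimately show ?thesis
    unfolding block_isometry_def[of "f \<circ> g"]
    using linear_compose[OF lin(2,1)] block_isometry_form[OF f] block_isometry_form[OF g] by simp
qed

lemma node_actionI:
  assumes "f (node_root n) = node_root m \<or> f (node_root n) = - node_root m"
  shows "node_action f n = m"
  unfolding node_action_def
  by (rule the_equality) (use assms node_root_unique in auto)

text \<open>The data of a block isometry in terms of \<open>node_action\<close>. The last property
  holds because positions inside an E8 copy are kept: a component mapped to itself is fixed node by
  node.\<close>

lemma block_isometryE:
  assumes "block_isometry f"
  obtains \<epsilon> where "\<And>C. \<epsilon> C \<in> {1, -1 :: real}"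
    "\<And>n. f (node_root n) = \<epsilon> (node_component n) *\<^sub>R node_root (node_action f n)"
    "\<And>m n. node_component m = node_component n \<Longrightarrow>
       node_component (node_action f m) = node_component (node_action f n)"
    "\<And>n. node_component (node_action f n) = node_component n \<Longrightarrow> node_action f n = n"
proof -
  obtain p q \<epsilon> where f: "\<And>n. \<epsilon> (node_component n) \<in> {1, -1 :: real}"
    "\<And>n. f (node_root n) = \<epsilon> (node_component n) *\<^sub>R node_root (map_sum p (map_prod q id) n)"
    using assms by (rule block_isometry_node_root) blast
  have act: "node_action f n = map_sum p (map_prod q id) n" for n
    using f[of n] by (intro node_actionI) auto
  \<comment> \<open>Every component contains a node, so the sign condition on nodes extends to all
    values of \<open>\<epsilon>\<close>.\<close>
  have "C \<in> range node_component" for C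
  proof (cases C)
    case (Inl i)
    then show ?thesis by (intro image_eqI[of _ _ "Inl i"]) auto
  next
    case (Inr j)
    then show ?thesis by (intro image_eqI[of _ _ "Inr (j, 1)"]) auto
  qed
  then have "\<epsilon> C \<in> {1, -1}" for C
    using f(1) by (metis rangeE)
  moreover have "map_sum p (map_prod q id) n = n" if "map_sum p q (node_component n) = node_component n" for n
    using that by (cases n rule: node_exhaust) auto
  ultimately show thesis
    using f(2) by (intro that[of \<epsilon>]) (auto simp: act node_component_map)
qed

lemma node_root_action:
  assumes "block_isometry f"
  shows "f (node_root n) = node_root (node_action f n) \<or> f (node_root n) = - node_root (node_action f n)"
proof -
  obtain p q \<epsilon> where "\<And>n. \<epsilon> (node_component n) \<in> {1, -1 :: real}"
    "\<And>n. f (node_root n) = \<epsilon> (node_component n) *\<^sub>R node_root (map_sum p (map_prod q id) n)"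
    using assms by (rule block_isometry_node_root) blast
  then have m: "f (node_root n) = node_root (map_sum p (map_prod q id) n)
      \<or> f (node_root n) = - node_root (map_sum p (map_prod q id) n)"
    by (metis insertE scaleR_minus1_left scaleR_one singletonD)
  then show ?thesis
    using node_actionI[of f n, OF m] by simp
qed

lemma node_action_id: "node_action id n = n"
  by (rule node_actionI) simp

lemma node_action_comp:
  assumes "block_isometry f" "block_isometry g"
  shows "node_action (f \<circ> g) n = node_action f (node_action g n)"
proof (rule node_actionI)
  have "linear f" using assms by (simp add: block_isometry_linear)
  then show "(f \<circ> g) (node_root n) = node_root (node_action f (node_action g n))
      \<or> (f \<circ> g) (node_root n) = - node_root (node_action f (node_action g n))"
    using node_root_action[OF assms(2), of n] node_root_action[OF assms(1), of "node_action g n"]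
    by (auto simp: linear_neg)
qed

text \<open>The absolute value makes adjacency insensitive to the signs with which an isometry
  permutes the roots.\<close>

lemma node_edge_iff_form: "node_edge m n \<longleftrightarrow> \<bar>k3_form (node_root m) (node_root n)\<bar> = 1"
proof -
  have "\<not> node_edge n n"
    by (cases n rule: node_exhaust) (auto simp: e8_edge_irrefl)
  then show ?thesis by (auto simp: node_root_form)
qed

lemma node_edge_action:
  assumes "block_isometry f"
  shows "node_edge (node_action f m) (node_action f n) \<longleftrightarrow> node_edge m n"
proof -
  have "k3_form (f (node_root m)) (f (node_root n)) = k3_form (node_root m) (node_root n)"
    using assms by (rule block_isometry_form)
  then have "\<bar>k3_form (node_root (node_action f m)) (node_root (node_action f n))\<bar> =
      \<bar>k3_form (node_root m) (node_root n)\<bar>"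
    using node_root_action[OF assms, of m] node_root_action[OF assms, of n]
    by (auto simp: k3_form_simps)
  then show ?thesis by (simp add: node_edge_iff_form)
qed

lemma block_isometry_lattice:
  assumes "block_isometry f" "a \<in> k3_lattice"
  shows "f a \<in> k3_lattice"
proof -
  have lin: "linear f" using assms by (simp add: block_isometry_linear)
  have w: "f w \<in> k3_lattice" if "w \<in> standard_basis" for w
    using block_isometry_standard_basis[OF assms(1) that] standard_basis_subset
      k3_lattice_minus[of "- f w"] by auto
  have "f a = (\<Sum>i\<in>UNIV. \<Sum>k\<in>UNIV. (fst a $ i $ k) *\<^sub>R f (u k i))
      + (\<Sum>j\<in>UNIV. \<Sum>k\<in>UNIV. (snd a $ j $ k) *\<^sub>R f (v k j))"
    by (subst k3_vector_expansion[of a])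
      (simp add: linear_add[OF lin] linear_sum[OF lin] linear_scale[OF lin])
  also have "\<dots> \<in> k3_lattice"
    using assms(2)
    by (intro k3_lattice_add k3_lattice_sum k3_lattice_scale w u_in_standard_basis v_in_standard_basis)
      (auto simp: k3_lattice_iff)
  finally show ?thesis .
qed

lemma block_isometry_involution:
  assumes "block_isometry f" "f \<circ> f = id"
  shows "k3_involution f"
  by (rule k3_involution.intro)
    (use assms in \<open>simp_all add: block_isometry_linear block_isometry_form block_isometry_lattice pointfree_idE\<close>)

text \<open>The identity serves as the common marking.\<close>

lemma simple_pair_block_isometry:
  assumes "block_isometry f" "block_isometry g"
  shows "simple_pair f g"
proof -
  have "isometry id"
    by (simp add: isometry_def linearI)
  moreover have "\<exists>w'\<in>standard_basis. h w = w' \<or> h w = - w'"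
    if "block_isometry h" "w \<in> standard_basis" for h w
  proof -
    show ?thesis
      using block_isometry_standard_basis[OF that] by (metis minus_minus)
  qed
  ultimately show ?thesis
    unfolding simple_pair_def using assms by (intro exI[of _ id]) auto
qed

section \<open>Isometries of the K3 lattice form a group\<close>

section \<open>The group of isometries\<close>

text \<open>Nondegeneracy of the form gives injectivity; finite dimension does the rest.\<close>

lemma isometry_bij:
  assumes "isometry f"
  shows "bij f"
proof -
  have lin: "linear f" using assms by (simp add: isometry_def)
  have "a = 0" if "f a = 0" for a
  proof (rule k3_form_nondegenerate)
    fix b
    have "k3_form a b = k3_form (f a) (f b)"
      using assms unfolding isometry_def by metis
    then show "k3_form a b = 0" using that by (simp add: k3_form_simps)
  qed
  then have "inj f" using lin by (simp add: linear_injective_0)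
  then show ?thesis
    using lin linear_injective_imp_surjective by (auto simp: bij_def)
qed

lemma isometry_inv:
  assumes "isometry f"
  shows "isometry (inv_into UNIV f)"
proof -
  note bij = isometry_bij[OF assms]
  have "linear (inv_into UNIV f)"
    using assms bij inj_linear_imp_inv_linear by (auto simp: isometry_def bij_def)
  moreover have "inv_into UNIV f ` k3_lattice = k3_lattice"
  proof -
    have "f ` k3_lattice = k3_lattice"
      using assms by (simp add: isometry_def)
    then have "inv_into UNIV f ` k3_lattice = inv_into UNIV f ` (f ` k3_lattice)"
      by simp
    also have "\<dots> = k3_lattice"
      using bij_is_inj[OF bij] by (rule image_inv_f_f)
    finally show ?thesis .
  qed
  moreover have "k3_form (inv_into UNIV f a) (inv_into UNIV f b) = k3_form a b" for a b
    using assms bij unfolding isometry_def by (metis bij_inv_eq_iff)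
  ultimately show ?thesis by (simp add: isometry_def)
qed

lemma group_isometry_group: "group isometry_group"
proof (rule groupI)
  fix f assume f: "f \<in> carrier isometry_group"
  then have "isometry f" by (simp add: isometry_group_def)
  then show "\<exists>f'\<in>carrier isometry_group. f' \<otimes>\<^bsub>isometry_group\<^esub> f = \<one>\<^bsub>isometry_group\<^esub>"
    using isometry_inv[of f] isometry_bij[of f]
    by (auto simp: isometry_group_def bij_def intro!: bexI[of _ "inv_into UNIV f"])
next
  fix f g assume "f \<in> carrier isometry_group" "g \<in> carrier isometry_group"
  then have "isometry f" "isometry g" by (simp_all add: isometry_group_def)
  then have "isometry (f \<circ> g)"
    unfolding isometry_def image_comp[symmetric] by (metis comp_apply linear_compose)
  then show "f \<otimes>\<^bsub>isometry_group\<^esub> g \<in> carrier isometry_group"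
    by (simp add: isometry_group_def)
qed (auto simp: isometry_group_def isometry_def comp_assoc intro: linearI)

section \<open>How the images of a root pair with the dual vector\<close>

section \<open>Pairing roots with a dual vector\<close>

text \<open>Expand \<open>d\<close> in the node roots: since \<open>k\<close> respects membership in
  \<open>M\<close>, only the coefficients at nodes of \<open>M\<close> survive the pairing.\<close>

lemma form_image_dual:
  fixes \<epsilon> \<kappa> :: "3 + 2 \<Rightarrow> real"
  assumes k: "block_isometry k" and M: "\<And>n. node_action k n \<in> M \<longleftrightarrow> n \<in> M"
    and \<theta>: "\<And>n. k3_form \<theta> (node_root n) = (if n \<in> M then \<kappa> (node_component n) else 0)"
    and d: "d \<in> root_space"
    and \<epsilon>: "\<And>n. k (node_root n) = \<epsilon> (node_component n) *\<^sub>R node_root (node_action k n)"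
  shows "k3_form (k d) \<theta> =
    (\<Sum>n\<in>M. node_coeff d n * \<epsilon> (node_component n) * \<kappa> (node_component (node_action k n)))"
proof -
  note lin = block_isometry_linear[OF k]
  have \<theta>': "k3_form (node_root n) \<theta> = (if n \<in> M then \<kappa> (node_component n) else 0)" for n
    by (simp only: \<theta> k3_form_commute[of "node_root n"])
  have "k d = (\<Sum>n\<in>UNIV. node_coeff d n *\<^sub>R k (node_root n))"
    by (subst root_space_expansion[OF d]) (simp add: linear_sum[OF lin] linear_scale[OF lin])
  then have "k3_form (k d) \<theta> = (\<Sum>n\<in>UNIV. node_coeff d n * \<epsilon> (node_component n) *
      (if n \<in> M then \<kappa> (node_component (node_action k n)) else 0))"
    by (simp add: k3_form_sum_left k3_form_simps \<epsilon> \<theta>' M mult.assoc)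
  also have "\<dots> = (\<Sum>n\<in>M. node_coeff d n * \<epsilon> (node_component n) *
      (if n \<in> M then \<kappa> (node_component (node_action k n)) else 0))"
    by (intro sum.mono_neutral_right) auto
  finally show ?thesis by simp
qed

lemma form_image_dual_eq_0:
  fixes \<kappa> :: "3 + 2 \<Rightarrow> real"
  assumes "block_isometry k" "\<And>n. node_action k n \<in> M \<longleftrightarrow> n \<in> M"
    and "\<And>n. k3_form \<theta> (node_root n) = (if n \<in> M then \<kappa> (node_component n) else 0)"
    and "d \<in> root_space" "\<And>n. n \<in> M \<Longrightarrow> node_coeff d n = 0"
  shows "k3_form (k d) \<theta> = 0"
proof -
  obtain \<epsilon> where \<epsilon>: "\<And>n. k (node_root n) = \<epsilon> (node_component n) *\<^sub>R node_root (node_action k n)"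
    by (rule block_isometryE[OF assms(1)]) (rule that, assumption)
  show ?thesis
    unfolding form_image_dual[OF assms(1-4) \<epsilon>] by (intro sum.neutral ballI) (simp add: assms(5))
qed

text \<open>A root lives in one component \<open>C\<close> with coefficients of one sign, so their
  absolute values over \<open>M\<close> have a positive sum \<open>s\<close>. The two products are
  \<open>\<delta> * \<epsilon> C * \<kappa> C' * s\<close> and
  \<open>\<delta> * \<kappa> C * s\<close>. Positivity of \<open>\<kappa>\<close> excludes the sign
  -1, and injectivity gives \<open>C' = C\<close>.\<close>

lemma equal_pairing_imp_fixed:
  fixes \<kappa> :: "3 + 2 \<Rightarrow> real"
  assumes k: "block_isometry k" and M: "\<And>n. node_action k n \<in> M \<longleftrightarrow> n \<in> M"
    and \<theta>: "\<And>n. k3_form \<theta> (node_root n) = (if n \<in> M then \<kappa> (node_component n) else 0)"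
    and \<kappa>: "inj \<kappa>" "\<And>C. \<kappa> C > 0"
    and d: "d \<in> root_space" "d \<in> k3_lattice" "k3_form d d = - 2"
    and eq: "k3_form (k d) \<theta> = k3_form d \<theta>"
    and n0: "n0 \<in> M" "node_coeff d n0 \<noteq> 0"
  shows "k (node_root n0) = node_root n0"
proof -
  obtain C where C: "\<And>n. node_component n \<noteq> C \<Longrightarrow> node_coeff d n = 0"
    using root_supported_in_component[OF d] by blast
  obtain \<delta> and c :: "node \<Rightarrow> nat"
    where \<delta>: "\<delta> \<in> {1, -1}" and c: "\<And>n. node_coeff d n = \<delta> * real (c n)"
    using root_coeffs_same_sign[OF d] by blast
  obtain \<epsilon> where \<epsilon>: "\<And>C. \<epsilon> C \<in> {1, -1 :: real}"
    "\<And>n. k (node_root n) = \<epsilon> (node_component n) *\<^sub>R node_root (node_action k n)"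
    "\<And>m n. node_component m = node_component n \<Longrightarrow>
       node_component (node_action k m) = node_component (node_action k n)"
    "\<And>n. node_component (node_action k n) = node_component n \<Longrightarrow> node_action k n = n"
    using block_isometryE[OF k] by blast
  define s where "s = (\<Sum>n\<in>M. real (c n))"
  define C' where "C' = node_component (node_action k n0)"
  have C0: "node_component n0 = C"
    using C n0 by blast
  have "s > 0"
    unfolding s_def using n0 c by (intro sum_pos2[of _ n0]) auto
  have support: "node_coeff d n * \<epsilon> (node_component n) * \<kappa> (node_component (node_action k n)) =
      \<delta> * \<epsilon> C * \<kappa> C' * real (c n)" for n
    using C[of n] C0 \<epsilon>(3)[of n n0] c[of n] \<delta> by (cases "node_component n = C") (auto simp: C'_def)
  have "k3_form (k d) \<theta> = \<delta> * \<epsilon> C * \<kappa> C' * s"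
    using form_image_dual[OF k M \<theta> d(1) \<epsilon>(2)]
    by (simp only: support s_def sum_distrib_left)
  \<comment> \<open>The same formula for the identity, with all signs 1, evaluates the product of
    \<open>d\<close> itself with \<open>\<theta>\<close>.\<close>
  moreover have "node_coeff d n * 1 * \<kappa> (node_component (node_action id n)) = \<delta> * \<kappa> C * real (c n)" for n
    using C[of n] c[of n] \<delta> by (cases "node_component n = C") (auto simp: node_action_id)
  then have "k3_form (id d) \<theta> = \<delta> * \<kappa> C * s"
    using form_image_dual[OF block_isometry_id _ \<theta> d(1), of "\<lambda>_. 1"]
    by (simp only: s_def sum_distrib_left node_action_id) (simp add: node_action_id)
  ultimately have "\<epsilon> C * \<kappa> C' = \<kappa> C"
    using eq \<open>s > 0\<close> \<delta> by auto
  then have "\<epsilon> C = 1" "\<kappa> C' = \<kappa> C"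
    using \<epsilon>(1)[of C] \<kappa>(2)[of C] \<kappa>(2)[of C'] by auto
  then have "node_action k n0 = n0"
    using \<epsilon>(4)[of n0] injD[OF \<kappa>(1)] by (simp add: C0 C'_def)
  then show ?thesis
    using \<epsilon>(2)[of n0] \<open>\<epsilon> C = 1\<close> by (simp add: C0)
qed

section \<open>Size and irrationality arguments for the perturbation\<close>

lemma eventually_quadratic_pos:
  fixes a b c :: real
  assumes "a > 0"
  shows "\<exists>s0. \<forall>s\<ge>s0. a * s\<^sup>2 + b * s + c > 0"
proof (intro exI allI impI)
  \<comment> \<open>The threshold ensures both \<open>s \<ge> 1\<close> and
    \<open>a * s \<ge> a + \<bar>b\<bar> + \<bar>c\<bar>\<close>.\<close>
  fix s assume s: "1 + (\<bar>b\<bar> + \<bar>c\<bar>) / a \<le> s"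
  have "0 \<le> (\<bar>b\<bar> + \<bar>c\<bar>) / a"
    using assms by simp
  then have s1: "1 \<le> s" using s by linarith
  have "a * (1 + (\<bar>b\<bar> + \<bar>c\<bar>) / a) \<le> a * s"
    using s assms by (intro mult_left_mono) auto
  moreover have "a * (1 + (\<bar>b\<bar> + \<bar>c\<bar>) / a) = a + \<bar>b\<bar> + \<bar>c\<bar>"
    using assms by (simp add: field_simps)
  ultimately have "a + \<bar>b\<bar> + \<bar>c\<bar> \<le> a * s" by simp
  then have "(a + \<bar>b\<bar> + \<bar>c\<bar>) * s \<le> a * s * s"
    using s1 by (intro mult_right_mono) auto
  moreover have "- (\<bar>b\<bar> * s) \<le> b * s"
    using s1 abs_ge_minus_self[of "b * s"] by (simp add: abs_mult)
  moreover have "\<bar>c\<bar> * 1 \<le> \<bar>c\<bar> * s"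
    using s1 by (intro mult_left_mono) auto
  moreover have "a * s > 0" using assms s1 by simp
  ultimately show "a * s\<^sup>2 + b * s + c > 0"
    by (simp add: power2_eq_square algebra_simps)
qed

lemma irrational_combination_eq_0:
  fixes r :: real
  assumes "r \<notin> \<rat>" "a \<in> \<int>" "b \<in> \<int>" "a + r * b = 0"
  shows "a = 0 \<and> b = 0"
proof -
  have "b = 0"
  proof (rule ccontr)
    assume "b \<noteq> 0"
    then have "r = - a / b" using assms(4) by (simp add: field_simps)
    then show False
      using assms by (metis Ints_subset_Rats Rats_divide Rats_minus_iff subsetD)
  qed
  then show ?thesis using assms(4) by simp
qed

text \<open>A labelling of the empty diagram writes every root as an empty sum, but 0 does not have
  square -2.\<close>

lemma root_system_empty:
  assumes "has_dynkin_diagram (root_system S') {} E"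
  shows "root_system S' = {}"
proof -
  have "d = 0" if "d \<in> root_system S'" for d
    using assms that by (auto simp: has_dynkin_diagram_def dynkin_labelling_def)
  moreover have "0 \<notin> root_system S'"
    by (auto simp: root_system_def k3_form_simps split: prod.splits)
  ultimately show ?thesis by blast
qed

section \<open>Deforming the Kaehler classes of a commuting pair\<close>

section \<open>Commuting pairs of involutions\<close>

text \<open>The classes \<open>x, y, z\<close> are lattice vectors on the lines spanned by the three Kaehler classes.\<close>

locale k3_involution_pair =
  fixes f g :: "k3_space \<Rightarrow> k3_space" and x y z :: k3_space
  assumes block: "block_isometry f" "block_isometry g"
    and ff: "f \<circ> f = id" and gg: "g \<circ> g = id" and fg: "f \<circ> g = g \<circ> f"
    and f_eigen: "f x = - x" "f y = - y" "f z = z"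
    and g_eigen: "g x = - x" "g y = y" "g z = - z"
    and lattice: "x \<in> k3_lattice" "y \<in> k3_lattice" "z \<in> k3_lattice"
    and positive: "k3_form x x > 0" "k3_form y y > 0" "k3_form z z > 0"
    and perp: "k3_form x a = 0 \<and> k3_form y a = 0 \<and> k3_form z a = 0 \<longleftrightarrow> a \<in> root_space"
begin

sublocale F: k3_involution f
  using block_isometry_involution[OF block(1) ff] .

sublocale G: k3_involution g
  using block_isometry_involution[OF block(2) gg] .

lemma gf: "g (f a) = f (g a)"
  using fun_cong[OF fg, of a] by simp

lemma comp_simps:
  "f \<circ> f = id" "g \<circ> g = id" "g \<circ> f = f \<circ> g"
  "f \<circ> (f \<circ> h) = h" "g \<circ> (g \<circ> h) = h" "g \<circ> (f \<circ> h) = f \<circ> (g \<circ> h)"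
  by (simp_all add: ff gg fg comp_assoc[symmetric])

text \<open>Eigenvectors of an isometry for the eigenvalues -1 and 1: their product equals its own
  negative.\<close>

lemma orthogonal:
  assumes "k3_involution h" "h a = - a" "h b = b"
  shows "k3_form a b = 0"
  using k3_involution.form[OF assms(1), of a b] assms by (simp add: k3_form_simps)

text \<open>Apart from the six eigenvalue equations, all conditions concern \<open>f\<close> and
  \<open>g\<close> only. They are settled here once, through the fixed classes \<open>x\<close>,
  \<open>y\<close>, \<open>z\<close>, for \<open>S\<close> and all its deformations.\<close>

lemma admits_pairI:
  assumes "f X = - X" "f Y = - Y" "f Z = Z" "g X = - X" "g Y = Y" "g Z = - Z"
  shows "admits_pair (X, Y, Z) f g"
proof -
  have "hyperbolic (fixed_lattice f)"
  proof (rule F.hyperbolic_fixed_lattice)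
    fix a assume a: "f a = a" "k3_form z a = 0" "a \<noteq> 0"
    \<comment> \<open>A vector fixed by \<open>f\<close> is automatically orthogonal to
      \<open>x\<close> and \<open>y\<close>, on which \<open>f\<close> is -1.\<close>
    have "a \<in> root_space"
      using orthogonal[OF F.k3_involution_axioms _ a(1)] f_eigen a(2) perp by blast
    then show "k3_form a a < 0"
      using a(3) by (rule root_space_negative_definite)
  qed (use f_eigen positive in auto)
  moreover have "hyperbolic (fixed_lattice g)"
  proof (rule G.hyperbolic_fixed_lattice)
    fix a assume a: "g a = a" "k3_form y a = 0" "a \<noteq> 0"
    have "a \<in> root_space"
      using orthogonal[OF G.k3_involution_axioms _ a(1)] g_eigen a(2) perp by blast
    then show "k3_form a a < 0"
      using a(3) by (rule root_space_negative_definite)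
  qed (use g_eigen positive in auto)
  ultimately show ?thesis
    unfolding admits_pair_def
    using assms ff gg fg F.isometry G.isometry simple_pair_block_isometry[OF block]
      F.two_elementary_fixed_lattice G.two_elementary_fixed_lattice by simp
qed

lemma dynkin_labelling_scaled_triple:
  assumes "r \<noteq> 0" "s \<noteq> 0" "t \<noteq> 0"
  shows "dynkin_labelling (root_system (r *\<^sub>R x, s *\<^sub>R y, t *\<^sub>R z)) UNIV node_edge node_root"
  using dynkin_labelling_node_root[where M = "{}" and D = "root_system (r *\<^sub>R x, s *\<^sub>R y, t *\<^sub>R z)"]
    perp assms by (simp add: root_system_def k3_form_simps)

lemma deformation:
  assumes M: "\<And>n. node_action f n \<in> M \<longleftrightarrow> n \<in> M" "\<And>n. node_action g n \<in> M \<longleftrightarrow> n \<in> M"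
    and not_fixed: "\<And>n. n \<in> M \<Longrightarrow> \<not> (f (node_root n) = node_root n \<and> g (node_root n) = node_root n)"
  obtains S' where "hyper_kaehler_k3 S'" "admits_pair S' f g"
    "dynkin_labelling (root_system S') (UNIV - M) node_edge node_root"
proof -
  \<comment> \<open>The weights must be integral for \<open>\<theta>\<close> to be a lattice vector,
    distinct to tell components apart, and positive, hence the added 1.\<close>
  obtain \<kappa>0 :: "3 + 2 \<Rightarrow> nat" where "inj \<kappa>0"
    using finite_imp_inj_to_nat_seg[of "UNIV :: (3 + 2) set"] by auto
  define \<kappa> where "\<kappa> C = real (\<kappa>0 C + 1)" for C
  have \<kappa>: "inj \<kappa>" "\<And>C. \<kappa> C > 0"
    using \<open>inj \<kappa>0\<close> by (auto simp: \<kappa>_def inj_def)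
  obtain \<theta> where \<theta>L: "\<theta> \<in> k3_lattice"
    and "\<And>n. k3_form \<theta> (node_root n) = of_int (if n \<in> M then int (\<kappa>0 (node_component n) + 1) else 0)"
    using node_dual_exists[of "\<lambda>n. if n \<in> M then int (\<kappa>0 (node_component n) + 1) else 0"] by blast
  then have \<theta>: "k3_form \<theta> (node_root n) = (if n \<in> M then \<kappa> (node_component n) else 0)" for n
    by (simp add: \<kappa>_def)
  obtain r :: real where r: "r \<notin> \<rat>"
    using countable_rat uncountable_UNIV_real by (metis UNIV_eq_I)

  \<comment> \<open>Four times the projections of \<open>\<theta>\<close> to the three joint
    eigenspaces; the factor 4 keeps them in the lattice.\<close>
  define \<eta>x where "\<eta>x = \<theta> - f \<theta> - g \<theta> + f (g \<theta>)"
  define \<eta>y where "\<eta>y = \<theta> - f \<theta> + g \<theta> - f (g \<theta>)"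
  define \<eta>z where "\<eta>z = \<theta> + f \<theta> - g \<theta> - f (g \<theta>)"
  have \<eta>L: "\<eta>x \<in> k3_lattice" "\<eta>y \<in> k3_lattice" "\<eta>z \<in> k3_lattice"
    unfolding \<eta>x_def \<eta>y_def \<eta>z_def
    by (intro k3_lattice_add k3_lattice_diff \<theta>L F.lattice G.lattice)+
  have f_\<eta>: "f \<eta>x = - \<eta>x" "f \<eta>y = - \<eta>y" "f \<eta>z = \<eta>z"
    by (simp_all add: \<eta>x_def \<eta>y_def \<eta>z_def F.simps)
  have g_\<eta>: "g \<eta>x = - \<eta>x" "g \<eta>y = \<eta>y" "g \<eta>z = - \<eta>z"
    by (simp_all add: \<eta>x_def \<eta>y_def \<eta>z_def G.simps gf)

  have perp_\<eta>: "k3_form \<eta>x d = 0 \<and> k3_form \<eta>y d = 0 \<and> k3_form \<eta>z d = 0 \<longleftrightarrow> (\<forall>n\<in>M. node_coeff d n = 0)"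
    if d: "d \<in> k3_lattice" "k3_form d d = - 2" "d \<in> root_space" for d
  proof -
    \<comment> \<open>Isometric involutions are self-adjoint, so images of \<open>\<theta>\<close>
      are traded for images of \<open>d\<close>.\<close>
    have f\<theta>: "k3_form (f \<theta>) d = k3_form (f d) \<theta>"
      using F.form[of "f \<theta>" d] by (simp add: F.involution k3_form_commute)
    have g\<theta>: "k3_form (g \<theta>) d = k3_form (g d) \<theta>"
      using G.form[of "g \<theta>" d] by (simp add: G.involution k3_form_commute)
    have fg\<theta>: "k3_form (f (g \<theta>)) d = k3_form ((g \<circ> f) d) \<theta>"
      using F.form[of "f (g \<theta>)" d] G.form[of "g \<theta>" "f d"]
      by (simp add: F.involution G.involution k3_form_commute)
    show ?thesis
    proof
      assume "k3_form \<eta>x d = 0 \<and> k3_form \<eta>y d = 0 \<and> k3_form \<eta>z d = 0"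
      \<comment> \<open>Adding the first equation to the second leaves the products with
        \<open>\<theta>\<close> and \<open>f \<theta>\<close>; adding it to the third leaves those
        with \<open>\<theta>\<close> and \<open>g \<theta>\<close>.\<close>
      then have "k3_form (f d) \<theta> = k3_form d \<theta>" "k3_form (g d) \<theta> = k3_form d \<theta>"
        by (simp_all add: \<eta>x_def \<eta>y_def \<eta>z_def k3_form_simps f\<theta> g\<theta> k3_form_commute[of \<theta>])
      then show "\<forall>n\<in>M. node_coeff d n = 0"
        using not_fixed equal_pairing_imp_fixed[OF block(1) M(1) \<theta> \<kappa> d(3,1,2)]
          equal_pairing_imp_fixed[OF block(2) M(2) \<theta> \<kappa> d(3,1,2)] by blast
    next
      assume "\<forall>n\<in>M. node_coeff d n = 0"
      then have *: "k3_form (k d) \<theta> = 0"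
        if "block_isometry k" "\<And>n. node_action k n \<in> M \<longleftrightarrow> n \<in> M" for k
        using form_image_dual_eq_0[OF that \<theta> d(3)] by blast
      have "k3_form ((g \<circ> f) d) \<theta> = 0"
        by (rule *[OF block_isometry_comp[OF block(2,1)]])
          (simp only: node_action_comp[OF block(2,1)] M)
      moreover have "k3_form (id d) \<theta> = 0"
        by (rule *[OF block_isometry_id]) (simp only: node_action_id)
      ultimately show "k3_form \<eta>x d = 0 \<and> k3_form \<eta>y d = 0 \<and> k3_form \<eta>z d = 0"
        using *[OF block(1) M(1)] *[OF block(2) M(2)]
        by (simp add: \<eta>x_def \<eta>y_def \<eta>z_def k3_form_simps f\<theta> g\<theta> fg\<theta> k3_form_commute[of \<theta>])
    qed
  qed

  \<comment> \<open>The multiple \<open>s\<close> is a natural number so that its contribution to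
    products with lattice vectors stays integral.\<close>
  define pert where "pert s a \<eta> = real s *\<^sub>R a + r *\<^sub>R \<eta>" for s :: nat and a \<eta> :: k3_space
  have "\<exists>s0. \<forall>s\<ge>s0. k3_form (pert s a \<eta>) (pert s a \<eta>) > 0" if a: "k3_form a a > 0" for a \<eta>
  proof -
    obtain s0 where s0: "\<And>s. s \<ge> s0 \<Longrightarrow>
        k3_form a a * s\<^sup>2 + 2 * r * k3_form a \<eta> * s + r\<^sup>2 * k3_form \<eta> \<eta> > 0"
      using eventually_quadratic_pos[OF a] by blast
    obtain n0 :: nat where "s0 \<le> real n0"
      using real_arch_simple by blast
    then have "\<forall>s\<ge>n0. k3_form a a * (real s)\<^sup>2 + 2 * r * k3_form a \<eta> * real s + r\<^sup>2 * k3_form \<eta> \<eta> > 0"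
      using s0 by (meson of_nat_mono order_trans)
    moreover have "k3_form (pert s a \<eta>) (pert s a \<eta>) =
        k3_form a a * (real s)\<^sup>2 + 2 * r * k3_form a \<eta> * real s + r\<^sup>2 * k3_form \<eta> \<eta>" for s
      by (simp add: pert_def k3_form_simps k3_form_commute[of \<eta> a] power2_eq_square algebra_simps)
    ultimately show ?thesis by auto
  qed
  then obtain sx sy sz where
    "\<And>s. s \<ge> sx \<Longrightarrow> k3_form (pert s x \<eta>x) (pert s x \<eta>x) > 0"
    "\<And>s. s \<ge> sy \<Longrightarrow> k3_form (pert s y \<eta>y) (pert s y \<eta>y) > 0"
    "\<And>s. s \<ge> sz \<Longrightarrow> k3_form (pert s z \<eta>z) (pert s z \<eta>z) > 0"
    using positive by metis
  \<comment> \<open>One multiple for all three classes; \<open>Suc\<close> makes it nonzero, which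
    \<open>pert_perp\<close> requires.\<close>
  moreover define s where "s = Suc (sx + sy + sz)"
  ultimately have pos: "k3_form (pert s x \<eta>x) (pert s x \<eta>x) > 0"
    "k3_form (pert s y \<eta>y) (pert s y \<eta>y) > 0" "k3_form (pert s z \<eta>z) (pert s z \<eta>z) > 0"
    by auto
  have "s > 0" by (simp add: s_def)

  have pert_perp: "k3_form (pert s a \<eta>) d = 0 \<longleftrightarrow> k3_form a d = 0 \<and> k3_form \<eta> d = 0"
    if "a \<in> k3_lattice" "\<eta> \<in> k3_lattice" "d \<in> k3_lattice" for a \<eta> d
  proof
    assume "k3_form (pert s a \<eta>) d = 0"
    then have "real s * k3_form a d + r * k3_form \<eta> d = 0"
      by (simp add: pert_def k3_form_simps)
    moreover have "real s * k3_form a d \<in> \<int>" "k3_form \<eta> d \<in> \<int>"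
      using that k3_form_Ints by auto
    ultimately have "real s * k3_form a d = 0 \<and> k3_form \<eta> d = 0"
      using irrational_combination_eq_0[OF r] by blast
    then show "k3_form a d = 0 \<and> k3_form \<eta> d = 0"
      using \<open>s > 0\<close> by simp
  qed (simp add: pert_def k3_form_simps)

  \<comment> \<open>Rescaling equalises the three squares without changing orthogonal
    complements.\<close>
  define unit where "unit a = (1 / sqrt (k3_form a a)) *\<^sub>R a" for a
  define X where "X = unit (pert s x \<eta>x)"
  define Y where "Y = unit (pert s y \<eta>y)"
  define Z where "Z = unit (pert s z \<eta>z)"
  have unit_form: "k3_form (unit a) (unit a) = 1" if "k3_form a a > 0" for a
    using that by (simp add: unit_def k3_form_simps)
  have unit_perp: "k3_form (unit a) d = 0 \<longleftrightarrow> k3_form a d = 0" if "k3_form a a > 0" for a d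
    using that by (simp add: unit_def k3_form_simps)
  have eigen: "h (unit (pert s a \<eta>)) = c *\<^sub>R unit (pert s a \<eta>)"
    if "linear h" "h a = c *\<^sub>R a" "h \<eta> = c *\<^sub>R \<eta>" for h :: "k3_space \<Rightarrow> k3_space" and c a \<eta>
    using that by (simp add: unit_def pert_def linear_scale linear_add scaleR_add_right mult_ac)
  have f: "f X = - X" "f Y = - Y" "f Z = Z"
    using eigen[OF F.linear, of _ "-1"] eigen[OF F.linear, of _ 1] f_\<eta> f_eigen
    by (simp_all add: X_def Y_def Z_def)
  have g: "g X = - X" "g Y = Y" "g Z = - Z"
    using eigen[OF G.linear, of _ "-1"] eigen[OF G.linear, of _ 1] g_\<eta> g_eigen
    by (simp_all add: X_def Y_def Z_def)
  \<comment> \<open>Orthogonality comes from the eigenvalues: \<open>g\<close> separates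
    \<open>X\<close> from \<open>Y\<close>, and \<open>f\<close> separates both from
    \<open>Z\<close>.\<close>
  have "hyper_kaehler_k3 (X, Y, Z)"
    using unit_form[OF pos(1)] unit_form[OF pos(2)] unit_form[OF pos(3)]
      orthogonal[OF G.k3_involution_axioms g(1,2)] orthogonal[OF F.k3_involution_axioms f(1,3)]
      orthogonal[OF F.k3_involution_axioms f(2,3)]
    by (simp add: hyper_kaehler_k3_def X_def Y_def Z_def)
  moreover have "admits_pair (X, Y, Z) f g"
    using f g by (rule admits_pairI)
  moreover have "dynkin_labelling (root_system (X, Y, Z)) (UNIV - M) node_edge node_root"
  proof (rule dynkin_labelling_node_root)
    fix d
    have "d \<in> root_system (X, Y, Z) \<longleftrightarrow> d \<in> k3_lattice \<and> k3_form d d = - 2 \<and>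
        (k3_form x d = 0 \<and> k3_form y d = 0 \<and> k3_form z d = 0) \<and>
        (k3_form \<eta>x d = 0 \<and> k3_form \<eta>y d = 0 \<and> k3_form \<eta>z d = 0)"
      unfolding root_system_def X_def Y_def Z_def
      using unit_perp[OF pos(1), of d] unit_perp[OF pos(2), of d] unit_perp[OF pos(3), of d]
        pert_perp[OF lattice(1) \<eta>L(1), of d] pert_perp[OF lattice(2) \<eta>L(2), of d]
        pert_perp[OF lattice(3) \<eta>L(3), of d]
      by auto
    then show "d \<in> root_system (X, Y, Z) \<longleftrightarrow> d \<in> k3_lattice \<and> k3_form d d = - 2 \<and> d \<in> root_space
        \<and> (\<forall>n\<in>M. node_coeff d n = 0)"
      unfolding perp using perp_\<eta> by blast
  qed
  ultimately show thesis by (rule that)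
qed

section \<open>The Klein four-group and its action on the diagram\<close>

text \<open>The four elements act on \<open>y\<close> and \<open>z\<close> by four different pairs
  of signs.\<close>

lemma distinct_group: "distinct [id, f, g, f \<circ> g]"
proof -
  have "- a \<noteq> a" if "k3_form a a > 0" for a
  proof
    assume "- a = a"
    then have "k3_form a a = - k3_form a a"
      using bilinear_lneg[OF bilinear_k3_form, of a a] by simp
    then show False using that by simp
  qed
  then have "- x \<noteq> x" "- y \<noteq> y" "- z \<noteq> z"
    using positive by blast+
  moreover have "id y = y" "f y = - y" "g y = y" "(f \<circ> g) y = - y"
    "id z = z" "f z = z" "g z = - z" "(f \<circ> g) z = - z"
    using f_eigen g_eigen by (simp_all add: F.simps)
  ultimately show ?thesis by (auto simp del: comp_apply)
qed

text \<open>As \<open>f\<close> and \<open>g\<close> commute, the four products are closed under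
  multiplication and each is its own inverse.\<close>

lemma carrier_generated_group: "carrier (generated_group f g) = {id, f, g, f \<circ> g}"
proof -
  interpret I: group isometry_group
    by (rule group_isometry_group)
  have H: "{id, f, g, f \<circ> g} \<subseteq> carrier isometry_group"
    using I.one_closed I.m_closed F.isometry G.isometry by (auto simp: isometry_group_def)
  have square: "h \<circ> h = id" if "h \<in> {id, f, g, f \<circ> g}" for h
    using that by (auto simp only: insert_iff empty_iff comp_simps comp_assoc id_comp comp_id)
  have "subgroup {id, f, g, f \<circ> g} isometry_group"
  proof (rule I.subgroupI[OF H])
    fix h assume h: "h \<in> {id, f, g, f \<circ> g}"
    then have "inv\<^bsub>isometry_group\<^esub> h = h"
      using square[OF h] H by (intro I.inv_equality) (auto simp: isometry_group_def)
    then show "inv\<^bsub>isometry_group\<^esub> h \<in> {id, f, g, f \<circ> g}" using h by simp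
  next
    fix h k assume "h \<in> {id, f, g, f \<circ> g}" "k \<in> {id, f, g, f \<circ> g}"
    then show "h \<otimes>\<^bsub>isometry_group\<^esub> k \<in> {id, f, g, f \<circ> g}"
      by (auto simp: isometry_group_def comp_simps comp_assoc)
  qed auto
  then have "generate isometry_group {f, g} \<subseteq> {id, f, g, f \<circ> g}"
    by (intro I.generate_subgroup_incl) auto
  moreover have "f \<circ> g \<in> generate isometry_group {f, g}"
    using generate.eng[of f isometry_group "{f, g}" g] generate.incl[of _ "{f, g}" isometry_group]
    by (simp add: isometry_group_def)
  moreover have "id \<in> generate isometry_group {f, g}"
    using generate.one[of isometry_group "{f, g}"] by (simp add: isometry_group_def)
  ultimately show ?thesis
    by (auto simp: generated_group_def intro: generate.incl)
qed

lemma mult_generated_group: "h \<otimes>\<^bsub>generated_group f g\<^esub> k = h \<circ> k"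
  by (simp add: generated_group_def isometry_group_def)

lemma group_generated_group: "group (generated_group f g)"
proof -
  interpret I: group isometry_group
    by (rule group_isometry_group)
  have "subgroup (generate isometry_group {f, g}) isometry_group"
    using F.isometry G.isometry by (intro I.generate_is_subgroup) (auto simp: isometry_group_def)
  then show ?thesis
    unfolding generated_group_def by (rule I.subgroup_imp_group)
qed

lemma block_isometry_generated_group: "h \<in> carrier (generated_group f g) \<Longrightarrow> block_isometry h"
  using block by (auto simp: carrier_generated_group intro: block_isometry_id block_isometry_comp)

lemma generated_group_iso:
  "generated_group f g \<cong> integer_mod_group 2 \<times>\<times> integer_mod_group 2"
proof -
  define h where "h = (\<lambda>(a :: int, b :: int). (if a = 0 then id else f) \<circ> (if b = 0 then id else g))"
  have carrier: "carrier (integer_mod_group 2 \<times>\<times> integer_mod_group 2) = {(0, 0), (0, 1), (1, 0), (1, 1)}"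
    by (auto simp: carrier_integer_mod_group)
  have "h \<in> hom (integer_mod_group 2 \<times>\<times> integer_mod_group 2) (generated_group f g)"
    by (rule homI; unfold carrier carrier_generated_group mult_generated_group)
      (auto simp: h_def comp_simps comp_assoc)
  moreover have "bij_betw h (carrier (integer_mod_group 2 \<times>\<times> integer_mod_group 2)) (carrier (generated_group f g))"
  proof -
    have "h (0, 0) = id" "h (0, 1) = g" "h (1, 0) = f" "h (1, 1) = f \<circ> g"
      by (simp_all add: h_def)
    then show ?thesis
      unfolding carrier carrier_generated_group bij_betw_def
      using distinct_group by (auto simp only: inj_on_def image_insert image_empty distinct.simps
          list.set insert_iff empty_iff)
  qed
  ultimately have "integer_mod_group 2 \<times>\<times> integer_mod_group 2 \<cong> generated_group f g"
    unfolding is_iso_def iso_def by blast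
  then show ?thesis
    by (rule group.iso_sym[OF DirProd_group[OF group_integer_mod_group group_integer_mod_group]])
qed

lemma node_action_involution:
  assumes "h \<in> carrier (generated_group f g)"
  shows "node_action h (node_action h n) = n"
proof -
  have "h \<circ> h = id"
    using assms unfolding carrier_generated_group
    by (auto simp only: insert_iff empty_iff comp_simps comp_assoc id_comp comp_id)
  then show ?thesis
    using node_action_comp[of h h n] block_isometry_generated_group[OF assms] node_action_id by simp
qed

lemma group_action_generated_group: "group_action (generated_group f g) UNIV node_action"
proof -
  have bij: "bij (node_action h)" if "h \<in> carrier (generated_group f g)" for h
    using node_action_involution[OF that] by (rule involuntory_imp_bij)
  have "node_action \<in> hom (generated_group f g) (BijGroup UNIV)"
  proof (rule homI)
    fix h k assume h: "h \<in> carrier (generated_group f g)" and k: "k \<in> carrier (generated_group f g)"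
    show "node_action h \<in> carrier (BijGroup UNIV)"
      using bij[OF h] by (simp add: BijGroup_def Bij_def)
    show "node_action (h \<otimes>\<^bsub>generated_group f g\<^esub> k) = node_action h \<otimes>\<^bsub>BijGroup UNIV\<^esub> node_action k"
      using bij[OF h] bij[OF k] node_action_comp[OF block_isometry_generated_group[OF h] block_isometry_generated_group[OF k]]
      by (simp add: BijGroup_def Bij_def mult_generated_group compose_def fun_eq_iff)
  qed
  then show ?thesis
    using group_generated_group group_BijGroup
    by (auto simp: group_action_def group_hom_def group_hom_axioms_def)
qed

section \<open>Deleting an invariant set of nodes\<close>

lemma deformations:
  assumes "\<forall>h\<in>carrier (generated_group f g). node_action h ` M \<subseteq> M"
    and not_fixed: "\<forall>n\<in>M. \<not> (f (node_root n) = node_root n \<and> g (node_root n) = node_root n)"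
  shows "\<exists>S' \<sigma>1 \<sigma>2. hyper_kaehler_k3 S' \<and> admits_pair S' \<sigma>1 \<sigma>2 \<and>
           invariants \<sigma>1 = invariants f \<and> invariants \<sigma>2 = invariants g \<and>
           has_dynkin_diagram (root_system S') (UNIV - M) node_edge"
proof -
  \<comment> \<open>Each group element acts as an involution on the nodes, so invariance by
    inclusion becomes an equivalence.\<close>
  have M: "node_action h n \<in> M \<longleftrightarrow> n \<in> M" if "h \<in> carrier (generated_group f g)" for h n
    using assms(1) that node_action_involution[OF that] by (metis image_subset_iff)
  obtain S' where S': "hyper_kaehler_k3 S'" "admits_pair S' f g"
    "dynkin_labelling (root_system S') (UNIV - M) node_edge node_root"
  proof (rule deformation)
    show "node_action f n \<in> M \<longleftrightarrow> n \<in> M" "node_action g n \<in> M \<longleftrightarrow> n \<in> M" for n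
      using M by (simp_all add: carrier_generated_group)
  qed (use not_fixed in blast)+
  show ?thesis
    by (rule exI[of _ S'], rule exI[of _ f], rule exI[of _ g])
      (use S' in \<open>auto simp: has_dynkin_diagram_def\<close>)
qed

text \<open>If no node root is fixed by both involutions, the set of all nodes may be
  deleted.\<close>

lemma smooth_deformation:
  assumes "\<nexists>n. f (node_root n) = node_root n \<and> g (node_root n) = node_root n"
  shows "\<exists>S' \<sigma>1 \<sigma>2. hyper_kaehler_k3 S' \<and> admits_pair S' \<sigma>1 \<sigma>2 \<and>
           invariants \<sigma>1 = invariants f \<and> invariants \<sigma>2 = invariants g \<and> root_system S' = {}"
proof -
  obtain S' \<sigma>1 \<sigma>2 where "hyper_kaehler_k3 S'" "admits_pair S' \<sigma>1 \<sigma>2"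
    "invariants \<sigma>1 = invariants f" "invariants \<sigma>2 = invariants g"
    "has_dynkin_diagram (root_system S') (UNIV - UNIV) node_edge"
    using deformations[of UNIV] assms by blast
  moreover from this have "root_system S' = {}"
    by (intro root_system_empty) simp
  ultimately show ?thesis by blast
qed

lemma admits_pair_scaled_triple: "admits_pair (r *\<^sub>R x, s *\<^sub>R y, t *\<^sub>R z) f g"
  by (rule admits_pairI) (simp_all add: F.simps G.simps f_eigen g_eigen)

end

section \<open>Coordinate checks for the explicit involutions and surfaces\<close>

section \<open>The explicit involutions\<close>

lemma exists_2: "(\<exists>i::2. P i) \<longleftrightarrow> P 1 \<or> P 2"
  by (metis exhaust_2)

lemma exists_3: "(\<exists>i::3. P i) \<longleftrightarrow> P 1 \<or> P 2 \<or> P 3"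
  by (metis exhaust_3)

text \<open>The hyperbolic half of \<open>block_isometry\<close>; \<open>axis 1 1 - axis 2 1\<close>
  is the A1 root in a plane. The signs of basis vectors and of A1 roots are separate conditions,
  since the interchange \<open>s\<close> fixes the basis up to order but negates the root.\<close>

definition hyp_isometry :: "(hyp_space \<Rightarrow> hyp_space) \<Rightarrow> bool" where
  "hyp_isometry F \<longleftrightarrow> linear F
     \<and> (\<forall>a b. (\<Sum>i\<in>UNIV. hyp_form (F a $ i) (F b $ i)) = (\<Sum>i\<in>UNIV. hyp_form (a $ i) (b $ i)))
     \<and> (\<forall>i k. \<exists>j l. F (axis i (axis k 1)) = axis j (axis l 1) \<or> F (axis i (axis k 1)) = - axis j (axis l 1))
     \<and> (\<forall>i. \<exists>j. \<exists>\<epsilon>\<in>{1, -1}. F (axis i (axis 1 1 - axis 2 1)) = \<epsilon> *\<^sub>R axis j (axis 1 1 - axis 2 1))"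

definition e8_isometry :: "(e8_space \<Rightarrow> e8_space) \<Rightarrow> bool" where
  "e8_isometry F \<longleftrightarrow> linear F
     \<and> (\<forall>a b. (\<Sum>i\<in>UNIV. neg_e8_form (F a $ i) (F b $ i)) = (\<Sum>i\<in>UNIV. neg_e8_form (a $ i) (b $ i)))
     \<and> (\<forall>i. \<exists>j. \<exists>\<epsilon>\<in>{1, -1}. \<forall>p. F (axis i p) = \<epsilon> *\<^sub>R axis j p)"

lemma block_isometry_map_prod:
  assumes H: "hyp_isometry H" and E: "e8_isometry E"
  shows "block_isometry (map_prod H E)"
proof -
  have lin: "linear H" "linear E"
    using H E by (auto simp: hyp_isometry_def e8_isometry_def)
  have "linear (map_prod H E)"
    by (auto intro!: linearI simp: linear_add[OF lin(1)] linear_add[OF lin(2)]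
        linear_scale[OF lin(1)] linear_scale[OF lin(2)] map_prod_def split_beta)
  moreover have "k3_form (map_prod H E a) (map_prod H E b) = k3_form a b" for a b
    using H E by (simp add: k3_form_def hyp_isometry_def e8_isometry_def)
  moreover have "map_prod H E w \<in> standard_basis \<or> - map_prod H E w \<in> standard_basis"
    if "w \<in> standard_basis" for w
    using that
  proof (cases rule: standard_basis_cases)
    case (1 k i)
    obtain j l where "H (axis i (axis k 1)) = axis j (axis l 1) \<or> H (axis i (axis k 1)) = - axis j (axis l 1)"
      using H unfolding hyp_isometry_def by blast
    then have "map_prod H E w = u l j \<or> - map_prod H E w = u l j"
      using 1 by (auto simp: u_def linear_0[OF lin(2)])
    then show ?thesis using u_in_standard_basis by metis
  next
    case (2 k i)
    obtain j \<epsilon> where "\<epsilon> \<in> {1, -1}" "E (axis i (axis k 1)) = \<epsilon> *\<^sub>R axis j (axis k 1)"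
      using E unfolding e8_isometry_def by blast
    then have "map_prod H E w = v k j \<or> - map_prod H E w = v k j"
      using 2 by (auto simp: v_def linear_0[OF lin(1)])
    then show ?thesis using v_in_standard_basis by metis
  qed
  moreover have "\<exists>p q \<epsilon>. \<forall>n. \<epsilon> (node_component n) \<in> {1, -1 :: real} \<and>
      map_prod H E (node_root n) = \<epsilon> (node_component n) *\<^sub>R node_root (map_sum p (map_prod q id) n)"
  proof -
    have "\<forall>i. \<exists>j \<epsilon>. \<epsilon> \<in> {1, -1} \<and> H (axis i (axis 1 1 - axis 2 1)) = \<epsilon> *\<^sub>R axis j (axis 1 1 - axis 2 1)"
      using H unfolding hyp_isometry_def by blast
    then obtain p \<alpha> where p: "\<And>i. \<alpha> i \<in> {1, -1 :: real}"
      "\<And>i. H (axis i (axis 1 1 - axis 2 1)) = \<alpha> i *\<^sub>R axis (p i) (axis 1 1 - axis 2 1)"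
      unfolding choice_iff by blast
    have "\<forall>i. \<exists>j \<epsilon>. \<epsilon> \<in> {1, -1} \<and> (\<forall>r. E (axis i r) = \<epsilon> *\<^sub>R axis j r)"
      using E unfolding e8_isometry_def by blast
    then obtain q \<beta> where q: "\<And>i. \<beta> i \<in> {1, -1 :: real}" "\<And>i r. E (axis i r) = \<beta> i *\<^sub>R axis (q i) r"
      unfolding choice_iff by blast
    have axis_diff: "axis i a - axis i b = axis i (a - b)" for i :: 3 and a b :: "real^2"
      by (simp add: vec_eq_iff axis_def)
    \<comment> \<open>The sign function on the five components is glued from those of the two
      halves.\<close>
    have "case_sum \<alpha> \<beta> (node_component n) \<in> {1, -1} \<and>
        map_prod H E (node_root n) = case_sum \<alpha> \<beta> (node_component n) *\<^sub>R node_root (map_sum p (map_prod q id) n)" for n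
      using p q by (cases n rule: node_exhaust)
        (simp_all add: u_def v_def axis_diff linear_0[OF lin(1)] linear_0[OF lin(2)])
    then show ?thesis by blast
  qed
  ultimately show ?thesis unfolding block_isometry_def by blast
qed

lemma tau_tau: "tau (tau h) = h"
  by (simp add: tau_def vec_eq_iff forall_3)

lemma rho1_conj_eq: "rho1_conj i h = tau (rho1 i (tau h))"
proof -
  have "inv_into UNIV tau = tau"
    using tau_tau by (intro inv_equality) auto
  then show ?thesis by (simp add: rho1_conj_def)
qed

lemma nat_range_7: "i \<in> {1..7} \<longleftrightarrow> i = 1 \<or> i = 2 \<or> i = 3 \<or> i = 4 \<or> i = 5 \<or> i = 6 \<or> i = (7::nat)"
  by (simp add: atLeastAtMost_iff) arith

lemma nat_range_4: "j \<in> {1..4} \<longleftrightarrow> j = 1 \<or> j = 2 \<or> j = 3 \<or> j = (4::nat)"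
  by (simp add: atLeastAtMost_iff) arith

lemmas rho1_simps = rho1_def rho1_conj_eq tau_def hyp_triple_def hyp_swap_def

lemma hyp_isometry_rho1: "i \<in> {1..7} \<Longrightarrow> hyp_isometry (rho1 i)"
  unfolding nat_range_7 hyp_isometry_def
  by (elim disjE; hypsubst; intro conjI linearI;
      simp add: rho1_simps sum_3 hyp_form_def vec_eq_iff forall_3 forall_2 exists_3 exists_2 axis_def algebra_simps)

lemma hyp_isometry_rho1_conj: "i \<in> {1..7} \<Longrightarrow> hyp_isometry (rho1_conj i)"
  unfolding nat_range_7 hyp_isometry_def
  by (elim disjE; hypsubst; intro conjI linearI;
      simp add: rho1_simps sum_3 hyp_form_def vec_eq_iff forall_3 forall_2 exists_3 exists_2 axis_def algebra_simps)

lemma e8_isometry_rho2: "j \<in> {1..4} \<Longrightarrow> e8_isometry (rho2 j)"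
proof -
  have E: "neg_e8_form (- p) (- q) = neg_e8_form p q" for p q
    by (simp add: neg_e8_form_expand)
  show "j \<in> {1..4} \<Longrightarrow> e8_isometry (rho2 j)"
    unfolding nat_range_4 e8_isometry_def
    by (elim disjE; hypsubst; intro conjI linearI;
      simp add: rho2_def E sum_2 vec_eq_iff forall_2 exists_2 axis_def)
qed

lemma rho1_involution: "i \<in> {1..7} \<Longrightarrow> rho1 i (rho1 i h) = h"
  unfolding nat_range_7
  by (elim disjE; hypsubst; simp add: rho1_simps vec_eq_iff forall_3 forall_2)

lemma rho1_conj_involution: "i \<in> {1..7} \<Longrightarrow> rho1_conj i (rho1_conj i h) = h"
  by (simp add: rho1_conj_eq tau_tau rho1_involution)

lemma rho2_involution: "j \<in> {1..4} \<Longrightarrow> rho2 j (rho2 j e) = e"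
  unfolding nat_range_4
  by (elim disjE; hypsubst; simp add: rho2_def vec_eq_iff forall_2)

text \<open>For \<open>i\<close> other than 7 both maps preserve each plane and act there by the
  identity or the interchange, up to sign. The map \<open>rho1 7\<close> exchanges the first two
  planes, so the conjugate must act alike on both; this fails for the indices 2 and 5.\<close>

lemma rho1_commute:
  assumes "i \<in> {1..7}" "j \<in> {1..7}" "j \<noteq> 7" "i = 7 \<Longrightarrow> j \<notin> {2, 5}"
  shows "rho1 i (rho1_conj j h) = rho1_conj j (rho1 i h)"
  using assms unfolding nat_range_7
  by (elim disjE; hypsubst; simp add: rho1_simps vec_eq_iff forall_3 forall_2)

text \<open>The excluded pairs combine the sign change on a single E8 copy with the exchange of the
  two copies.\<close>

lemma rho2_commute:
  assumes "i \<in> {1..4}" "j \<in> {1..4}" "(i, j) \<notin> {(2, 4), (4, 2)}"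
  shows "rho2 i (rho2 j e) = rho2 j (rho2 i e)"
  using assms unfolding nat_range_4
  by (elim disjE; hypsubst; simp add: rho2_def vec_eq_iff forall_2)

lemma first_involution_block: "i1 \<in> {1..7} \<Longrightarrow> j1 \<in> {1..4} \<Longrightarrow> block_isometry (first_involution i1 i2 j1)"
  by (simp add: first_involution_def block_isometry_map_prod hyp_isometry_rho1 hyp_isometry_rho1_conj
      e8_isometry_rho2)

lemma second_involution_block:
  "i2 \<in> {1..7} \<Longrightarrow> j2 \<in> {1..4} \<Longrightarrow> block_isometry (second_involution i1 i2 j2)"
  by (simp add: second_involution_def block_isometry_map_prod hyp_isometry_rho1 hyp_isometry_rho1_conj
      e8_isometry_rho2)

lemma first_involution_involution:
  "i1 \<in> {1..7} \<Longrightarrow> j1 \<in> {1..4} \<Longrightarrow> first_involution i1 i2 j1 \<circ> first_involution i1 i2 j1 = id"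
  by (rule ext) (simp add: first_involution_def map_prod_def split_beta rho1_involution
      rho1_conj_involution rho2_involution)

lemma second_involution_involution:
  "i2 \<in> {1..7} \<Longrightarrow> j2 \<in> {1..4} \<Longrightarrow> second_involution i1 i2 j2 \<circ> second_involution i1 i2 j2 = id"
  by (rule ext) (simp add: second_involution_def map_prod_def split_beta rho1_involution
      rho1_conj_involution rho2_involution)

lemma involutions_commute:
  assumes "i1 \<in> {1..7}" "j1 \<in> {1..4}" "i2 \<in> {1..7}" "j2 \<in> {1..4}"
    and "(j1, j2) \<notin> {(2, 4), (4, 2)}"
    and "(i1, i2) \<notin> {(2, 7), (5, 7), (7, 2), (7, 5), (7, 7)}"
  shows "first_involution i1 i2 j1 \<circ> second_involution i1 i2 j2 =
    second_involution i1 i2 j2 \<circ> first_involution i1 i2 j1"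
proof (rule ext)
  fix a
  have "i1 \<noteq> 7" "i1 \<notin> {2, 5}" if "i2 = 7"
    using assms(6) that by auto
  moreover have "i2 \<notin> {2, 5}" if "i1 = 7"
    using assms(6) that by auto
  ultimately show "(first_involution i1 i2 j1 \<circ> second_involution i1 i2 j2) a =
      (second_involution i1 i2 j2 \<circ> first_involution i1 i2 j1) a"
    \<comment> \<open>The second instance covers \<open>i2 = 7\<close>, where the conjugated map
      belongs to the first involution.\<close>
    using rho1_commute[of i1 i2 "fst a"] rho1_commute[of 7 i1 "fst a"]
      rho2_commute[OF assms(2,4,5), of "snd a"] assms(1,3)
    by (auto simp add: first_involution_def second_involution_def map_prod_def split_beta)
qed

lemma u_coordinates: "fst (u k i) = axis i (axis k 1)" "snd (u k i) = 0"
  by (simp_all add: u_def)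

lemma k3_form_u_left:
  "k3_form (u 1 i) a = fst a $ i $ 2" "k3_form (u 2 i) a = fst a $ i $ 1"
  by (simp_all only: k3_form_commute[of "u _ _"] k3_form_u)

lemma rho2_0: "j \<in> {1..4} \<Longrightarrow> rho2 j 0 = 0"
  unfolding nat_range_4 by (elim disjE; hypsubst; simp add: rho2_def vec_eq_iff forall_2)

lemma k3_involution_pair_generic:
  assumes "i1 \<in> {1..7}" "j1 \<in> {1..4}" "i2 \<in> {1..7}" "j2 \<in> {1..4}"
    and "(j1, j2) \<notin> {(2, 4), (4, 2)}" and "i1 \<noteq> 7" "i2 \<noteq> 7"
  shows "k3_involution_pair (first_involution i1 i2 j1) (second_involution i1 i2 j2)
    (u 1 2 + u 2 2) (u 1 3 + u 2 3) (u 1 1 + u 2 1)"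
proof
  let ?x = "u 1 2 + u 2 2" and ?y = "u 1 3 + u 2 3" and ?z = "u 1 1 + u 2 1"
  have "rho1 i (fst ?x) = - fst ?x" "rho1 i (fst ?y) = - fst ?y" "rho1 i (fst ?z) = fst ?z"
    "rho1_conj i (fst ?x) = - fst ?x" "rho1_conj i (fst ?y) = fst ?y" "rho1_conj i (fst ?z) = - fst ?z"
    if "i \<in> {1..7}" "i \<noteq> 7" for i
    using that unfolding nat_range_7
    by (elim disjE; hypsubst; simp add: rho1_simps u_coordinates vec_eq_iff forall_3 forall_2 axis_def)+
  then show "first_involution i1 i2 j1 ?x = - ?x" "first_involution i1 i2 j1 ?y = - ?y"
    "first_involution i1 i2 j1 ?z = ?z"
    "second_involution i1 i2 j2 ?x = - ?x" "second_involution i1 i2 j2 ?y = ?y"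
    "second_involution i1 i2 j2 ?z = - ?z"
    using assms by (simp_all add: first_involution_def second_involution_def prod_eq_iff
        u_coordinates rho2_0 del: atLeastAtMost_iff)
  show "k3_form ?x a = 0 \<and> k3_form ?y a = 0 \<and> k3_form ?z a = 0 \<longleftrightarrow> a \<in> root_space" for a
    by (auto simp: k3_form_simps k3_form_u_left root_space_def forall_3 add.commute)
  have "(i1, i2) \<notin> {(2, 7), (5, 7), (7, 2), (7, 5), (7, 7)}"
    using assms(6,7) by auto
  then show "first_involution i1 i2 j1 \<circ> second_involution i1 i2 j2 =
      second_involution i1 i2 j2 \<circ> first_involution i1 i2 j1"
    by (rule involutions_commute[OF assms(1-5)])
qed (use assms in \<open>simp_all add: first_involution_block second_involution_block
    first_involution_involution second_involution_involution k3_form_simps k3_form_u_left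
    u_coordinates axis_def k3_lattice_add u_in_k3_lattice del: atLeastAtMost_iff\<close>)

text \<open>The second class appears without its factor \<open>sqrt 2\<close>, because the locale
  works with lattice vectors; the factor returns as a scalar in the theorem.\<close>

lemma k3_involution_pair_left_7:
  assumes "j1 \<in> {1..4}" "i2 \<in> {1..7}" "j2 \<in> {1..4}"
    and "(j1, j2) \<notin> {(2, 4), (4, 2)}" and "i2 \<notin> {2, 5, 7}"
  shows "k3_involution_pair (first_involution 7 i2 j1) (second_involution 7 i2 j2)
    (u 1 1 + u 2 1 - u 1 2 - u 2 2) (u 1 3 + u 2 3) (u 1 1 + u 2 1 + u 1 2 + u 2 2)"
proof
  let ?x = "u 1 1 + u 2 1 - u 1 2 - u 2 2" and ?y = "u 1 3 + u 2 3" and ?z = "u 1 1 + u 2 1 + u 1 2 + u 2 2"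
  have 7: "rho1 7 (fst ?x) = - fst ?x" "rho1 7 (fst ?y) = - fst ?y" "rho1 7 (fst ?z) = fst ?z"
    by (simp_all add: rho1_simps u_coordinates vec_eq_iff forall_3 forall_2 axis_def)
  have "rho1_conj i2 (fst ?x) = - fst ?x" "rho1_conj i2 (fst ?y) = fst ?y" "rho1_conj i2 (fst ?z) = - fst ?z"
    using assms(2,5) unfolding nat_range_7
    by (elim disjE; hypsubst; simp add: rho1_simps u_coordinates vec_eq_iff forall_3 forall_2 axis_def)+
  then show "first_involution 7 i2 j1 ?x = - ?x" "first_involution 7 i2 j1 ?y = - ?y"
    "first_involution 7 i2 j1 ?z = ?z"
    "second_involution 7 i2 j2 ?x = - ?x" "second_involution 7 i2 j2 ?y = ?y"
    "second_involution 7 i2 j2 ?z = - ?z"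
    using assms 7 by (simp_all add: first_involution_def second_involution_def prod_eq_iff
        u_coordinates rho2_0 del: atLeastAtMost_iff)
  \<comment> \<open>Sum and difference of the conditions for \<open>?x\<close> and \<open>?z\<close>
    separate the first two hyperbolic planes.\<close>
  show "k3_form ?x a = 0 \<and> k3_form ?y a = 0 \<and> k3_form ?z a = 0 \<longleftrightarrow> a \<in> root_space" for a
    by (simp add: k3_form_simps k3_form_u_left root_space_def forall_3) linarith
  have "(7, i2) \<notin> {(2, 7), (5, 7), (7, 2), (7, 5), (7, 7)}"
    using assms(5) by auto
  then show "first_involution 7 i2 j1 \<circ> second_involution 7 i2 j2 =
      second_involution 7 i2 j2 \<circ> first_involution 7 i2 j1"
    using assms by (intro involutions_commute) auto
qed (use assms in \<open>simp_all add: first_involution_block second_involution_block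
    first_involution_involution second_involution_involution k3_form_simps k3_form_u_left
    u_coordinates axis_def k3_lattice_add k3_lattice_diff u_in_k3_lattice\<close>)

lemma k3_involution_pair_right_7:
  assumes "i1 \<in> {1..7}" "j1 \<in> {1..4}" "j2 \<in> {1..4}"
    and "(j1, j2) \<notin> {(2, 4), (4, 2)}" and "i1 \<notin> {2, 5, 7}"
  shows "k3_involution_pair (first_involution i1 7 j1) (second_involution i1 7 j2)
    (u 1 1 + u 2 1 - u 1 2 - u 2 2) (u 1 1 + u 2 1 + u 1 2 + u 2 2) (u 1 3 + u 2 3)"
proof
  let ?x = "u 1 1 + u 2 1 - u 1 2 - u 2 2" and ?y = "u 1 1 + u 2 1 + u 1 2 + u 2 2" and ?z = "u 1 3 + u 2 3"
  have 7: "rho1 7 (fst ?x) = - fst ?x" "rho1 7 (fst ?y) = fst ?y" "rho1 7 (fst ?z) = - fst ?z"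
    by (simp_all add: rho1_simps u_coordinates vec_eq_iff forall_3 forall_2 axis_def)
  have "rho1_conj i1 (fst ?x) = - fst ?x" "rho1_conj i1 (fst ?y) = - fst ?y" "rho1_conj i1 (fst ?z) = fst ?z"
    using assms(1,5) unfolding nat_range_7
    by (elim disjE; hypsubst; simp add: rho1_simps u_coordinates vec_eq_iff forall_3 forall_2 axis_def)+
  then show "first_involution i1 7 j1 ?x = - ?x" "first_involution i1 7 j1 ?y = - ?y"
    "first_involution i1 7 j1 ?z = ?z"
    "second_involution i1 7 j2 ?x = - ?x" "second_involution i1 7 j2 ?y = ?y"
    "second_involution i1 7 j2 ?z = - ?z"
    using assms 7 by (simp_all add: first_involution_def second_involution_def prod_eq_iff
        u_coordinates rho2_0 del: atLeastAtMost_iff)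
  show "k3_form ?x a = 0 \<and> k3_form ?y a = 0 \<and> k3_form ?z a = 0 \<longleftrightarrow> a \<in> root_space" for a
    by (simp add: k3_form_simps k3_form_u_left root_space_def forall_3) linarith
  have "(i1, 7) \<notin> {(2, 7), (5, 7), (7, 2), (7, 5), (7, 7)}"
    using assms(5) by auto
  then show "first_involution i1 7 j1 \<circ> second_involution i1 7 j2 =
      second_involution i1 7 j2 \<circ> first_involution i1 7 j1"
    using assms by (intro involutions_commute) auto
qed (use assms in \<open>simp_all add: first_involution_block second_involution_block
    first_involution_involution second_involution_involution k3_form_simps k3_form_u_left
    u_coordinates axis_def k3_lattice_add k3_lattice_diff u_in_k3_lattice\<close>)

theorem theorem6p6:
  fixes i1 j1 i2 j2 :: nat
    and S :: k3_triple
    and \<rho>1 \<rho>2 :: "k3_space \<Rightarrow> k3_space"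
    and G :: "(k3_space \<Rightarrow> k3_space) monoid"
  assumes "i1 \<in> {1..7}" "j1 \<in> {1..4}" "i2 \<in> {1..7}" "j2 \<in> {1..4}"
    and "(j1, j2) \<notin> {(2, 4), (4, 2)}"
    and "(i1, i2) \<notin> {(2, 7), (5, 7), (7, 2), (7, 5), (7, 7)}"
    and S: "S = k3_surface i1 i2"
    and \<rho>1: "\<rho>1 = first_involution i1 i2 j1"
    and \<rho>2: "\<rho>2 = second_involution i1 i2 j2"
    and G: "G = generated_group \<rho>1 \<rho>2"
  shows
    "hyper_kaehler_k3 S \<and>
     admits_pair S \<rho>1 \<rho>2 \<and>
     has_dynkin_diagram (root_system S) (UNIV :: node set) node_edge \<and>
     dynkin_labelling (root_system S) UNIV node_edge node_root \<and>
     G \<cong> integer_mod_group 2 \<times>\<times> integer_mod_group 2 \<and>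
     group_action G UNIV node_action \<and>
     (\<forall>g\<in>carrier G. \<forall>n.
        g (node_root n) = node_root (node_action g n) \<or>
        g (node_root n) = - node_root (node_action g n)) \<and>
     (\<forall>g\<in>carrier G. \<forall>m n.
        node_edge (node_action g m) (node_action g n) \<longleftrightarrow> node_edge m n) \<and>
     (\<forall>M :: node set.
        (\<forall>g\<in>carrier G. node_action g ` M \<subseteq> M) \<and>
        (\<forall>n\<in>M. \<not> (\<rho>1 (node_root n) = node_root n \<and> \<rho>2 (node_root n) = node_root n)) \<longrightarrow>
        (\<exists>S' \<sigma>1 \<sigma>2. hyper_kaehler_k3 S' \<and> admits_pair S' \<sigma>1 \<sigma>2 \<and>
           invariants \<sigma>1 = invariants \<rho>1 \<and> invariants \<sigma>2 = invariants \<rho>2 \<and>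
           has_dynkin_diagram (root_system S') (UNIV - M) node_edge)) \<and>
     ((\<nexists>n. \<rho>1 (node_root n) = node_root n \<and> \<rho>2 (node_root n) = node_root n) \<longrightarrow>
        (\<exists>S' \<sigma>1 \<sigma>2. hyper_kaehler_k3 S' \<and> admits_pair S' \<sigma>1 \<sigma>2 \<and>
           invariants \<sigma>1 = invariants \<rho>1 \<and> invariants \<sigma>2 = invariants \<rho>2 \<and>
           root_system S' = {}))"
proof -
  \<comment> \<open>All squares are 2 in the generic case. If an index is 7 they are 4, two classes
    being spread over two planes and the third scaled by \<open>sqrt 2\<close>.\<close>
  have "hyper_kaehler_k3 S"
    unfolding S k3_surface_def hyper_kaehler_k3_def
    by (simp add: k3_form_simps k3_form_u_left u_coordinates axis_def)
  \<comment> \<open>The scalars \<open>r\<close>, \<open>s\<close>, \<open>t\<close> absorb the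
    factor \<open>sqrt 2\<close>, so that one locale instance covers all three kinds of index
    pairs.\<close>
  obtain x y z :: k3_space and r s t :: real where pair: "k3_involution_pair \<rho>1 \<rho>2 x y z"
    and S_eq: "S = (r *\<^sub>R x, s *\<^sub>R y, t *\<^sub>R z)" and scale: "r \<noteq> 0" "s \<noteq> 0" "t \<noteq> 0"
  proof (cases "i1 = 7")
    case True
    then have "i2 \<notin> {2, 5, 7}" using assms(6) by auto
    then have "k3_involution_pair \<rho>1 \<rho>2
        (u 1 1 + u 2 1 - u 1 2 - u 2 2) (u 1 3 + u 2 3) (u 1 1 + u 2 1 + u 1 2 + u 2 2)"
      unfolding \<rho>1 \<rho>2 True by (intro k3_involution_pair_left_7 assms(2-5))
    then show thesis
      by (rule that[where r = 1 and s = "sqrt 2" and t = 1]) (simp_all add: S k3_surface_def True)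
  next
    case False
    show thesis
    proof (cases "i2 = 7")
      case True
      then have "i1 \<notin> {2, 5, 7}" using assms(6) by auto
      then have "k3_involution_pair \<rho>1 \<rho>2
          (u 1 1 + u 2 1 - u 1 2 - u 2 2) (u 1 1 + u 2 1 + u 1 2 + u 2 2) (u 1 3 + u 2 3)"
        unfolding \<rho>1 \<rho>2 True by (intro k3_involution_pair_right_7 assms(1,2,4,5))
      then show thesis
        by (rule that[where r = 1 and s = 1 and t = "sqrt 2"])
          (use False in \<open>simp_all add: S k3_surface_def True\<close>)
    next
      case 2: False
      have "k3_involution_pair \<rho>1 \<rho>2 (u 1 2 + u 2 2) (u 1 3 + u 2 3) (u 1 1 + u 2 1)"
        unfolding \<rho>1 \<rho>2 by (intro k3_involution_pair_generic assms(1-5) False 2)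
      then show thesis
        by (rule that[where r = 1 and s = 1 and t = 1])
          (use False 2 in \<open>simp_all add: S k3_surface_def\<close>)
    qed
  qed
  interpret k3_involution_pair \<rho>1 \<rho>2 x y z by (rule pair)
  have labelling: "dynkin_labelling (root_system S) UNIV node_edge node_root"
    unfolding S_eq by (rule dynkin_labelling_scaled_triple[OF scale])
  show ?thesis
    unfolding G
  proof (intro conjI)
    show "\<forall>M :: node set.
        (\<forall>g\<in>carrier (generated_group \<rho>1 \<rho>2). node_action g ` M \<subseteq> M) \<and>
        (\<forall>n\<in>M. \<not> (\<rho>1 (node_root n) = node_root n \<and> \<rho>2 (node_root n) = node_root n)) \<longrightarrow>
        (\<exists>S' \<sigma>1 \<sigma>2. hyper_kaehler_k3 S' \<and> admits_pair S' \<sigma>1 \<sigma>2 \<and>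
           invariants \<sigma>1 = invariants \<rho>1 \<and> invariants \<sigma>2 = invariants \<rho>2 \<and>
           has_dynkin_diagram (root_system S') (UNIV - M) node_edge)"
      using deformations by blast
    show "(\<nexists>n. \<rho>1 (node_root n) = node_root n \<and> \<rho>2 (node_root n) = node_root n) \<longrightarrow>
        (\<exists>S' \<sigma>1 \<sigma>2. hyper_kaehler_k3 S' \<and> admits_pair S' \<sigma>1 \<sigma>2 \<and>
           invariants \<sigma>1 = invariants \<rho>1 \<and> invariants \<sigma>2 = invariants \<rho>2 \<and>
           root_system S' = {})"
      using smooth_deformation by blast
    show "has_dynkin_diagram (root_system S) (UNIV :: node set) node_edge"
      using labelling by (auto simp: has_dynkin_diagram_def)
    show "admits_pair S \<rho>1 \<rho>2"
      unfolding S_eq by (rule admits_pair_scaled_triple)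
  qed (use \<open>hyper_kaehler_k3 S\<close> labelling generated_group_iso group_action_generated_group
      node_root_action node_edge_action block_isometry_generated_group in blast)+
qed

end
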